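(* Let $A$ be a unital Banach algebra with unit $1_A$, let $(C(t))_{t\in\mathbb{R}}$ be a cosine function in $A$ (i.e. $C(0)=1_A$ and $C(s+t)+C(s-t)=2C(s)C(t)$ for all $s,t\in\mathbb{R}$; no continuity is assumed), and let $A_1$ be the closed subalgebra of $A$ generated by $\{C(t):t\in\mathbb{R}\}$. For $a\in\mathbb{R}$ and $m\ge0$ let $\Omega(a,m)=\{b\ge0:\ \sup_{t\in\mathbb{R}}|\cos(ta)-\cos(tb)|\le m\}$. (i) If $m:=\sup_{t\in\mathbb{R}}\Vert C(t)-\cos(at)1_A\Vert<2$ for some $a\in\mathbb{R}$, then $A_1$ is isomorphic to $\mathbb{C}^k$ for some $k\le\mathrm{card}(\Omega(a,m))$, and there exist pairwise orthogonal idempotents $p_1,\dots,p_k$ of $A_1$ and distinct elements $b_1,\dots,b_k$ of $\Omega(a,m)$ such that $C(t)=\sum_{j=1}^k\cos(b_jt)p_j$ for all $t\in\mathbb{R}$. (ii) If $\sup_{t\in\mathbb{R}}\Vert C(t)-\cos(at)1_A\Vert<\frac{8}{3\sqrt3}$ for some $a\in\mathbb{R}$, then $C(t)=\cos(at)1_A$ for all $t\in\mathbb{R}$. *)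

theory Defs
  imports "HOL-Analysis.Analysis"
begin

class complex_banach_algebra = real_normed_algebra_1 + banach +
  fixes cscale :: "complex \<Rightarrow> 'a \<Rightarrow> 'a"
  assumes cscale_of_real: "cscale (complex_of_real r) x = r *\<^sub>R x"
    and cscale_add_left: "cscale (c + d) x = cscale c x + cscale d x"
    and cscale_add_right: "cscale c (x + y) = cscale c x + cscale c y"
    and cscale_mult: "cscale (c * d) x = cscale c (cscale d x)"
    and norm_cscale: "norm (cscale c x) = cmod c * norm x"
    and cscale_left_mult: "cscale c x * y = cscale c (x * y)"
    and cscale_right_mult: "x * cscale c y = cscale c (x * y)"

definition cosine_function :: "(real \<Rightarrow> 'a::complex_banach_algebra) \<Rightarrow> bool" where
  "cosine_function C \<longleftrightarrow> C 0 = 1 \<and>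
     (\<forall>s t. C (s + t) + C (s - t) = 2 * (C s * C t))"

definition closed_subalgebra :: "'a::complex_banach_algebra set \<Rightarrow> bool" where
  "closed_subalgebra S \<longleftrightarrow> closed S \<and> 0 \<in> S \<and>
     (\<forall>x\<in>S. \<forall>y\<in>S. x + y \<in> S \<and> x * y \<in> S) \<and>
     (\<forall>c. \<forall>x\<in>S. cscale c x \<in> S)"

definition generated_closed_subalgebra :: "'a::complex_banach_algebra set \<Rightarrow> 'a set" where
  "generated_closed_subalgebra X = \<Inter>{S. closed_subalgebra S \<and> X \<subseteq> S}"

text \<open>The algebra \<open>\<complex>^k\<close>, realised as functions \<open>nat \<Rightarrow> complex\<close> vanishing outside \<open>{..<k}\<close>,
  with pointwise operations.\<close>
definition Cpow :: "nat \<Rightarrow> (nat \<Rightarrow> complex) set" where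
  "Cpow k = {f. \<forall>j\<ge>k. f j = 0}"

definition alg_iso_Cpow :: "'a::complex_banach_algebra set \<Rightarrow> nat \<Rightarrow> ('a \<Rightarrow> nat \<Rightarrow> complex) \<Rightarrow> bool" where
  "alg_iso_Cpow S k \<phi> \<longleftrightarrow> bij_betw \<phi> S (Cpow k) \<and>
     (\<forall>x\<in>S. \<forall>y\<in>S. \<phi> (x + y) = (\<lambda>j. \<phi> x j + \<phi> y j) \<and> \<phi> (x * y) = (\<lambda>j. \<phi> x j * \<phi> y j)) \<and>
     (\<forall>c. \<forall>x\<in>S. \<phi> (cscale c x) = (\<lambda>j. c * \<phi> x j))"

definition Omega :: "real \<Rightarrow> real \<Rightarrow> real set" where
  "Omega a m = {b. b \<ge> 0 \<and> (SUP t. \<bar>cos (t * a) - cos (t * b)\<bar>) \<le> m}"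

end

theory Submission
  imports Defs
begin

text \<open>
  No spectral theory is needed. Let \<open>\<parallel>C t - cos (a t)\<parallel> \<le> m < 2\<close>, fix \<open>\<tau>\<close> and put
  \<open>w n = ((1 + cos (n a \<tau>)) / 2) ^ r * ((1 - C (n \<tau>)) / 2) ^ r\<close>. By the arithmetic-geometric mean
  inequality \<open>\<parallel>w n\<parallel> \<le> ((1 + m/2)\<^sup>2 / 4) ^ r\<close>, which for large \<open>r\<close> is smaller than the constant term
  \<open>(4 ^ (-r) * (2 r choose r))\<^sup>2\<close> in the expansion of \<open>w n\<close> into products
  \<open>cos (j n a \<tau>) C (l n \<tau>)\<close>. Multiplying the average of a non-constant term over \<open>n < M\<close> by
  \<open>C (l \<tau>) - cos (j a \<tau>)\<close> gives a telescoping sum, hence something of size \<open>O(1/M)\<close>. So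
  \<open>Q = \<Prod> (C (l \<tau>) - cos (j a \<tau>))\<close> satisfies \<open>\<parallel>Q\<parallel> \<le> \<theta> \<parallel>Q\<parallel>\<close> with \<open>\<theta> < 1\<close>, that is,
  \<open>Q = 0\<close> (for \<open>a = 0\<close> the first factor of \<open>w\<close> is omitted). Taking \<open>\<tau> = t / L\<close> with \<open>L\<close> divisible by all \<open>l\<close> shows that
  \<open>\<Prod> (C t - cos (b t)) = 0\<close> over a finite set of frequencies \<open>b\<close> that does not depend on \<open>t\<close>.

  Interpolation at one small \<open>t\<close> splits \<open>1\<close> into eigenvectors \<open>p b\<close>. That \<open>C u\<close> acts on
  \<open>p b\<close> as \<open>cos (b u)\<close> is clear for rational multiples \<open>u\<close> of that \<open>t\<close>. It extends to all reals
  without continuity, because \<open>C (t - u)\<close> acts on a joint eigenvector with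
  frequencies \<open>c\<close> (for \<open>t\<close>) and \<open>b\<close> (for \<open>u\<close>) with eigenvalues \<open>cos (c t \<plusminus> b u)\<close>, which for \<open>u\<close>
  close to \<open>t\<close> are not of the form \<open>cos (d (t - u))\<close> unless \<open>c = b\<close>.
\<close>

section \<open>Products of commuting factors\<close>

lemma prod_list_commute:
  fixes x :: "'a::monoid_mult"
  assumes "\<And>y. y \<in> set ys \<Longrightarrow> x * y = y * x"
  shows "x * prod_list ys = prod_list ys * x"
  using assms
proof (induction ys)
  case (Cons y ys)
  have "x * prod_list (y # ys) = y * (x * prod_list ys)"
    using Cons.prems[of y] by (simp flip: mult.assoc)
  then show ?case using Cons by (simp add: mult.assoc)
qed simp

text \<open>Factors are exchanged one at a time: the new factor \<open>g x\<close> is moved past the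
  rest and absorbed into \<open>z\<close>, which therefore varies in the induction. This carries
  relations at multiples of a small argument over to a single \<open>t\<close>.\<close>

lemma prod_list_transfer_annihilation:
  fixes f g :: "'b \<Rightarrow> 'a::ring_1"
  assumes "\<And>x y. x \<in> set xs \<Longrightarrow> y \<in> set xs \<Longrightarrow> f x * g y = g y * f x"
    and "\<And>x y. x \<in> set xs \<Longrightarrow> y \<in> set xs \<Longrightarrow> g x * g y = g y * g x"
    and "\<And>x w. x \<in> set xs \<Longrightarrow> f x * w = 0 \<Longrightarrow> g x * w = 0"
    and "prod_list (map f xs) * z = 0"
  shows "prod_list (map g xs) * z = 0"
  using assms
proof (induction xs arbitrary: z)
  case (Cons x xs)
  have "f x * (prod_list (map f xs) * z) = 0"
    using Cons.prems(4) by (simp add: mult.assoc)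
  then have "g x * (prod_list (map f xs) * z) = 0"
    using Cons.prems(3)[of x] by simp
  moreover have "g x * prod_list (map f xs) = prod_list (map f xs) * g x"
    by (rule prod_list_commute) (use Cons.prems(1) in auto)
  ultimately have "prod_list (map f xs) * (g x * z) = 0"
    by (simp flip: mult.assoc)
  then have "prod_list (map g xs) * (g x * z) = 0"
    using Cons.prems(1-3) by (intro Cons.IH) auto
  moreover have "g x * prod_list (map g xs) = prod_list (map g xs) * g x"
    by (rule prod_list_commute) (use Cons.prems(2) in auto)
  ultimately show ?case by (simp add: mult.assoc)
qed simp

text \<open>The square of a factor kills no more than the factor itself, so repetitions can be
  merged. Again the head factor is absorbed into \<open>z\<close>.\<close>

lemma prod_list_remdups_annihilation:
  fixes f :: "'b \<Rightarrow> 'a::ring_1"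
  assumes "\<And>x y. x \<in> set xs \<Longrightarrow> y \<in> set xs \<Longrightarrow> f x * f y = f y * f x"
    and "\<And>x w. x \<in> set xs \<Longrightarrow> f x * (f x * w) = 0 \<Longrightarrow> f x * w = 0"
    and "prod_list (map f xs) * z = 0"
  shows "prod_list (map f (remdups xs)) * z = 0"
  using assms
proof (induction xs arbitrary: z)
  case (Cons x xs)
  have comm: "f x * prod_list (map f ys) = prod_list (map f ys) * f x" if "set ys \<subseteq> set xs" for ys
    by (rule prod_list_commute) (use Cons.prems(1) that in auto)
  have "prod_list (map f xs) * (f x * z) = 0"
    using Cons.prems(3) comm[of xs] by (simp add: mult.assoc[symmetric])
  then have *: "prod_list (map f (remdups xs)) * (f x * z) = 0"
    using Cons.prems(1,2) by (intro Cons.IH) auto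
  show ?case
  proof (cases "x \<in> set xs")
    case False
    then show ?thesis using * comm[of "remdups xs"] by (simp add: mult.assoc)
  next
    case True
    then obtain us vs where uv: "remdups xs = us @ x # vs"
      by (metis set_remdups split_list)
    have s: "set us \<subseteq> set xs" "set vs \<subseteq> set xs"
      using uv by (metis Un_subset_iff set_append set_remdups set_subset_Cons subset_trans order_refl)+
    let ?U = "prod_list (map f us)" and ?V = "prod_list (map f vs)"
    \<comment> \<open>One copy of \<open>f x\<close> survives in \<open>remdups xs\<close>, the
      other sits in front of \<open>z\<close>. Commuting both to the left produces the square to
      which the kernel condition applies.\<close>
    have "f x * (f x * (?U * (?V * z))) = ?U * (f x * (?V * (f x * z)))"
      using comm[OF s(1)] comm[OF s(2)] by (metis mult.assoc)
    also have "\<dots> = 0" using * uv by (simp add: mult.assoc)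
    finally have "f x * (?U * (?V * z)) = 0" using Cons.prems(2)[of x] by simp
    then have "?U * (f x * (?V * z)) = 0" using comm[OF s(1)] by (metis mult.assoc)
    then show ?thesis using True uv by (simp add: mult.assoc)
  qed
qed simp

text \<open>The two polynomials in \<open>y\<close> that kill \<open>z\<close> have no common root.
  Stripping off one linear factor leaves a vector \<open>w\<close> with
  \<open>y * w = g b *\<^sub>R w\<close>, on which the quadratic acts as the nonzero scalar
  \<open>(g b - c) * (g b - d)\<close>.\<close>

lemma cancel_prod_list:
  fixes y :: "'a::real_algebra_1"
  assumes "\<And>b. b \<in> set bs \<Longrightarrow> g b \<noteq> c \<and> g b \<noteq> d"
    and "(y - c *\<^sub>R 1) * ((y - d *\<^sub>R 1) * z) = 0"
    and "prod_list (map (\<lambda>b. y - g b *\<^sub>R 1) bs) * z = 0"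
  shows "z = 0"
  using assms
proof (induction bs)
  case (Cons b bs)
  define w where "w = prod_list (map (\<lambda>b. y - g b *\<^sub>R 1) bs) * z"
  have "(y - g b *\<^sub>R 1) * w = 0" using Cons.prems(3) by (simp add: w_def mult.assoc)
  then have yw: "y * w = g b *\<^sub>R w" by (simp add: algebra_simps)
  let ?P = "prod_list (map (\<lambda>b. y - g b *\<^sub>R 1) bs)"
  have "(y - e *\<^sub>R 1) * ?P = ?P * (y - e *\<^sub>R 1)" for e
    by (rule prod_list_commute) (auto simp: algebra_simps)
  then have comm: "(y - e *\<^sub>R 1) * (?P * v) = ?P * ((y - e *\<^sub>R 1) * v)" for e v
    by (simp flip: mult.assoc)
  have "(y - c *\<^sub>R 1) * ((y - d *\<^sub>R 1) * w) = 0"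
    unfolding w_def comm Cons.prems(2) by simp
  moreover have "(y - c *\<^sub>R 1) * ((y - d *\<^sub>R 1) * w) = ((g b - c) * (g b - d)) *\<^sub>R w"
    using yw by (simp add: algebra_simps)
  ultimately have "w = 0" using Cons.prems(1)[of b] by simp
  then show ?case using Cons.IH Cons.prems(1,2) unfolding w_def by auto
qed simp

text \<open>A polynomial with simple roots splits its kernel into eigenspaces. The invariant
  subspace \<open>S\<close> is carried along so that the components stay in a given subalgebra or
  remain eigenvectors of other elements.\<close>

lemma eigen_splitting:
  fixes y :: "'a::real_algebra_1"
  assumes "distinct bs" and "inj_on g (set bs)"
    and "subspace S" and "\<And>w. w \<in> S \<Longrightarrow> y * w \<in> S" and "z \<in> S"
    and "prod_list (map (\<lambda>b. y - g b *\<^sub>R 1) bs) * z = 0"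
  shows "\<exists>\<zeta>. z = (\<Sum>b\<in>set bs. \<zeta> b) \<and> (\<forall>b\<in>set bs. \<zeta> b \<in> S \<and> y * \<zeta> b = g b *\<^sub>R \<zeta> b)"
  using assms
proof (induction bs arbitrary: z)
  case (Cons b bs)
  define z1 where "z1 = (y - g b *\<^sub>R 1) * z"
  have z1S: "z1 \<in> S"
    using Cons.prems(3-5) by (simp add: z1_def left_diff_distrib subspace_diff subspace_scale)
  have comm: "(y - g b *\<^sub>R 1) * prod_list (map (\<lambda>b. y - g b *\<^sub>R 1) bs)
      = prod_list (map (\<lambda>b. y - g b *\<^sub>R 1) bs) * (y - g b *\<^sub>R 1)"
    by (rule prod_list_commute) (auto simp: algebra_simps)
  have "prod_list (map (\<lambda>b. y - g b *\<^sub>R 1) bs) * z1 = 0"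
    using Cons.prems(6) comm by (simp add: z1_def mult.assoc[symmetric])
  then obtain \<zeta> where sum: "z1 = (\<Sum>b\<in>set bs. \<zeta> b)"
    and \<zeta>: "\<And>c. c \<in> set bs \<Longrightarrow> \<zeta> c \<in> S" "\<And>c. c \<in> set bs \<Longrightarrow> y * \<zeta> c = g c *\<^sub>R \<zeta> c"
    using Cons.IH[OF _ _ Cons.prems(3,4) z1S] Cons.prems(1,2) by auto
  have ne: "g c \<noteq> g b" if "c \<in> set bs" for c
    using that Cons.prems(1,2) by (auto simp: inj_on_def)
  \<comment> \<open>On the eigenspace for \<open>g c\<close>, \<open>y - g b\<close> acts as
    \<open>g c - g b\<close>, so \<open>\<xi> c\<close> is a preimage of \<open>\<zeta> c\<close>.
    What is left of \<open>z\<close> is killed by \<open>y - g b\<close>.\<close>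
  define \<xi> where "\<xi> c = inverse (g c - g b) *\<^sub>R \<zeta> c" for c
  define x where "x = z - (\<Sum>c\<in>set bs. \<xi> c)"
  have \<xi>: "\<xi> c \<in> S" "y * \<xi> c = g c *\<^sub>R \<xi> c" if "c \<in> set bs" for c
    using \<zeta>[OF that] Cons.prems(3) by (auto simp: \<xi>_def subspace_scale)
  have "(y - g b *\<^sub>R 1) * (\<Sum>c\<in>set bs. \<xi> c) = (\<Sum>c\<in>set bs. \<zeta> c)"
    unfolding sum_distrib_left
  proof (rule sum.cong)
    fix c assume c: "c \<in> set bs"
    have "(y - g b *\<^sub>R 1) * \<xi> c = (g c - g b) *\<^sub>R \<xi> c"
      using \<xi>(2)[OF c] by (simp add: left_diff_distrib scaleR_left_diff_distrib)
    then show "(y - g b *\<^sub>R 1) * \<xi> c = \<zeta> c" using ne[OF c] by (simp add: \<xi>_def)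
  qed simp
  then have "(y - g b *\<^sub>R 1) * x = 0"
    using sum by (simp add: x_def z1_def right_diff_distrib)
  then have yx: "y * x = g b *\<^sub>R x" by (simp add: left_diff_distrib)
  have xS: "x \<in> S"
    using Cons.prems(3,5) \<xi>(1) unfolding x_def by (intro subspace_diff subspace_sum) auto
  have b: "b \<notin> set bs" using Cons.prems(1) by simp
  have "z = (\<Sum>c\<in>set (b # bs). (\<xi>(b := x)) c)"
  proof -
    have "(\<Sum>c\<in>set bs. (\<xi>(b := x)) c) = (\<Sum>c\<in>set bs. \<xi> c)"
      using b by (intro sum.cong) auto
    then show ?thesis using b by (simp add: x_def)
  qed
  then show ?case using xS yx \<xi> by (intro exI[of _ "\<xi>(b := x)"]) auto
qed simp

section \<open>Binomial expansion of powers of (1 + cos) / 2\<close>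

lemma sum_binomial_Suc:
  fixes f :: "nat \<Rightarrow> 'a::real_vector"
  shows "(\<Sum>k\<le>Suc n. real (Suc n choose k) *\<^sub>R f k)
    = (\<Sum>k\<le>n. real (n choose k) *\<^sub>R f k) + (\<Sum>k\<le>n. real (n choose k) *\<^sub>R f (Suc k))"
proof -
  have "(\<Sum>k\<le>Suc n. real (Suc n choose k) *\<^sub>R f k)
      = f 0 + (\<Sum>k\<le>n. (real (n choose k) + real (n choose Suc k)) *\<^sub>R f (Suc k))"
    by (subst sum.atMost_Suc_shift) simp
  also have "\<dots> = (f 0 + (\<Sum>k\<le>n. real (n choose Suc k) *\<^sub>R f (Suc k)))
      + (\<Sum>k\<le>n. real (n choose k) *\<^sub>R f (Suc k))"
    by (simp add: scaleR_left_distrib sum.distrib)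
  also have "f 0 + (\<Sum>k\<le>n. real (n choose Suc k) *\<^sub>R f (Suc k))
      = (\<Sum>k\<le>Suc n. real (n choose k) *\<^sub>R f k)"
    by (subst sum.atMost_Suc_shift) simp
  finally show ?thesis by simp
qed

text \<open>In the model case \<open>D i = cos (i * x)\<close> the base is the square of
  \<open>cos (x / 2)\<close>, hence the binomial coefficients of order \<open>2 * r\<close>. The
  abstract sequence covers both scalar cosines and the alternating values of
  \<open>C\<close>.\<close>

lemma half_plus_cosine_power:
  fixes D :: "int \<Rightarrow> 'a::real_algebra_1"
  assumes "D 0 = 1" and "\<And>i. D (i + 1) + D (i - 1) = 2 * (D i * D 1)"
  shows "((1/2) *\<^sub>R (1 + D 1)) ^ r
    = (\<Sum>k\<le>2*r. (real (2*r choose k) / 4 ^ r) *\<^sub>R D (int k - int r))"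
proof (induction r)
  case (Suc r)
  \<comment> \<open>Multiplication by the base applies the weights 1/4, 1/2, 1/4, which is Pascal's
    rule used twice.\<close>
  have step: "D i * ((1/2) *\<^sub>R (1 + D 1)) = (1/4) *\<^sub>R (D (i - 1) + 2 *\<^sub>R D i + D (i + 1))" for i
  proof -
    have "D i * D 1 = (1/2) *\<^sub>R (D (i + 1) + D (i - 1))"
      unfolding assms(2) by (simp add: scaleR_2[symmetric] mult_2)
    then show ?thesis by (simp add: algebra_simps)
  qed
  let ?b = "\<lambda>k. real (2*r choose k)"
  have "((1/2) *\<^sub>R (1 + D 1)) ^ Suc r
      = (\<Sum>k\<le>2*r. (?b k / 4 ^ r) *\<^sub>R D (int k - int r)) * ((1/2) *\<^sub>R (1 + D 1))"
    unfolding power_Suc2 Suc ..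
  also have "\<dots> = (\<Sum>k\<le>2*r. (?b k / 4 ^ r) *\<^sub>R (D (int k - int r) * ((1/2) *\<^sub>R (1 + D 1))))"
    unfolding sum_distrib_right mult_scaleR_left ..
  also have "\<dots> = (\<Sum>k\<le>2*r. (1 / 4 ^ Suc r) *\<^sub>R (?b k *\<^sub>R
      (D (int k - int r - 1) + 2 *\<^sub>R D (int k - int r) + D (int k - int r + 1))))"
    unfolding step by (intro sum.cong) (auto simp: field_simps)
  also have "\<dots> = (1 / 4 ^ Suc r) *\<^sub>R (\<Sum>k\<le>2*r. ?b k *\<^sub>R
      (D (int k - int r - 1) + 2 *\<^sub>R D (int k - int r) + D (int k - int r + 1)))"
    unfolding scaleR_sum_right ..
  also have "(\<Sum>k\<le>2*r. ?b k *\<^sub>R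
      (D (int k - int r - 1) + 2 *\<^sub>R D (int k - int r) + D (int k - int r + 1)))
      = (\<Sum>k\<le>Suc (Suc (2*r)). real (Suc (Suc (2*r)) choose k) *\<^sub>R D (int k - int (Suc r)))"
    unfolding sum_binomial_Suc
    by (simp add: scaleR_right_distrib sum.distrib scaleR_2 algebra_simps)
  also have "(1 / 4 ^ Suc r) *\<^sub>R \<dots>
     = (\<Sum>k\<le>2 * Suc r. (real (2 * Suc r choose k) / 4 ^ Suc r) *\<^sub>R D (int k - int (Suc r)))"
    by (simp add: scaleR_sum_right del: sum.atMost_Suc binomial_Suc_Suc)
  finally show ?case .
qed (use assms in simp)

section \<open>Bounded cosine families\<close>

locale cosine_family =
  fixes C :: "real \<Rightarrow> 'a::real_normed_algebra_1"
  assumes zero: "C 0 = 1"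
    and dAlembert: "C (s + t) + C (s - t) = 2 * (C s * C t)"
begin

lemma mult_eq: "C s * C t = (1/2) *\<^sub>R (C (s + t) + C (s - t))"
  unfolding dAlembert by (simp add: scaleR_2[symmetric] mult_2)

lemma minus: "C (- t) = C t"
  using dAlembert[of 0 t] by (simp add: zero mult_2)

lemma abs_arg: "C \<bar>t\<bar> = C t"
  by (simp add: abs_if minus)

lemma commute: "C s * C t = C t * C s"
  using minus[of "s - t"] by (simp add: mult_eq add.commute)

text \<open>\<open>C (n s)\<close> and \<open>cos (n \<phi>)\<close> obey the same Chebyshev
  recurrence in \<open>n\<close>.\<close>

lemma eigen_multiple:
  assumes "C s * w = cos \<phi> *\<^sub>R w"
  shows "C (real n * s) * w = cos (real n * \<phi>) *\<^sub>R w"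
proof (induction n rule: less_induct)
  case (less n)
  consider "n = 0" | "n = 1" | k where "n = Suc (Suc k)"
    by (metis One_nat_def not0_implies_Suc)
  then show ?case
  proof cases
    case 3
    have "C (real n * s) = 2 *\<^sub>R (C (real (Suc k) * s) * C s) - C (real k * s)"
      by (simp add: mult_eq 3 algebra_simps)
    then have "C (real n * s) * w = 2 *\<^sub>R (C (real (Suc k) * s) * (C s * w)) - C (real k * s) * w"
      by (simp add: left_diff_distrib mult.assoc)
    also have "\<dots> = (2 * cos \<phi> * cos (real (Suc k) * \<phi>) - cos (real k * \<phi>)) *\<^sub>R w"
      unfolding assms using less[of "Suc k"] less[of k] 3 by (simp add: scaleR_left_diff_distrib mult_ac)
    also have "2 * cos \<phi> * cos (real (Suc k) * \<phi>) - cos (real k * \<phi>) = cos (real n * \<phi>)"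
      using cos_times_cos[of "real (Suc k) * \<phi>" \<phi>] by (simp add: 3 algebra_simps)
    finally show ?thesis .
  qed (use assms zero in auto)
qed

end

text \<open>Makes the estimates for cosine families available for scalar trigonometric sums.\<close>

lemma cosine_family_cos: "cosine_family (\<lambda>t. cos (c * t))" for c :: real
  by unfold_locales (simp_all add: cos_times_cos algebra_simps)

locale bounded_cosine_family = cosine_family +
  fixes K :: real
  assumes bounded: "norm (C t) \<le> K"
begin

text \<open>The angle is stored separately from the argument because the expansion of
  \<open>w\<close> pairs a multiple of \<open>a * \<tau>\<close> with an independent multiple of
  \<open>\<tau>\<close>, possibly 0.\<close>

definition factor :: "real \<times> real \<Rightarrow> 'a" where
  "factor = (\<lambda>(s, \<phi>). C s - cos \<phi> *\<^sub>R 1)"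

lemma factor_commute: "factor x * factor y = factor y * factor x"
  by (auto simp: factor_def algebra_simps commute split: prod.split)

lemma factor_C_commute: "factor x * C t = C t * factor x"
  by (auto simp: factor_def algebra_simps commute split: prod.split)

lemma factor_mult_eq_0: "factor (s, \<phi>) * w = 0 \<longleftrightarrow> C s * w = cos \<phi> *\<^sub>R w"
  by (simp add: factor_def left_diff_distrib)

text \<open>The sum telescopes because both \<open>C (n s)\<close> and \<open>cos (n \<phi>)\<close> satisfy a three-term recurrence
  (a discrete Wronskian).\<close>
lemma norm_factor_times_sum_le:
  "norm (factor (s, \<phi>) * (\<Sum>n<M. cos (real n * \<phi>) *\<^sub>R C (real n * s))) \<le> 2 * K"
proof -
  define E where "E n = cos ((real n - 1) * \<phi>) *\<^sub>R C (real n * s)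
      - cos (real n * \<phi>) *\<^sub>R C ((real n - 1) * s)" for n
  have E: "norm (E n) \<le> 2 * K" for n
  proof -
    have "norm (E n) \<le> \<bar>cos ((real n - 1) * \<phi>)\<bar> * norm (C (real n * s))
        + \<bar>cos (real n * \<phi>)\<bar> * norm (C ((real n - 1) * s))"
      unfolding E_def by (rule order_trans[OF norm_triangle_ineq4]) simp
    also have "\<dots> \<le> 1 * K + 1 * K"
      by (intro add_mono mult_mono bounded) auto
    finally show ?thesis by simp
  qed
  have "factor (s, \<phi>) * (cos (real n * \<phi>) *\<^sub>R C (real n * s)) = (1/2) *\<^sub>R (E (Suc n) - E n)" for n
  proof -
    have 1: "C s * C (real n * s) = (1/2) *\<^sub>R (C ((1 + real n) * s) + C ((real n - 1) * s))"
      using mult_eq[of "real n * s" s] by (simp add: commute algebra_simps)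
    have 2: "cos \<phi> * cos (real n * \<phi>) = (1/2) * (cos ((1 + real n) * \<phi>) + cos ((real n - 1) * \<phi>))"
      using cos_times_cos[of "real n * \<phi>" \<phi>] by (simp add: algebra_simps)
    have "factor (s, \<phi>) * (cos (real n * \<phi>) *\<^sub>R C (real n * s))
        = cos (real n * \<phi>) *\<^sub>R (C s * C (real n * s)) - (cos \<phi> * cos (real n * \<phi>)) *\<^sub>R C (real n * s)"
      by (simp add: factor_def left_diff_distrib scaleR_right_diff_distrib mult.commute)
    then show ?thesis unfolding 1 2 by (simp add: E_def scaleR_right_diff_distrib scaleR_left_distrib
          scaleR_right_distrib add_divide_distrib)
  qed
  then have "factor (s, \<phi>) * (\<Sum>n<M. cos (real n * \<phi>) *\<^sub>R C (real n * s)) = (1/2) *\<^sub>R (E M - E 0)"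
    by (simp add: sum_distrib_left scaleR_sum_right[symmetric] sum_lessThan_telescope)
  moreover have "norm (E M - E 0) \<le> 2 * K + 2 * K"
    by (rule order_trans[OF norm_triangle_ineq4]) (intro add_mono E)
  ultimately show ?thesis by simp
qed

text \<open>By commutation the matching factor can be placed next to the sum. Its telescoping bound
  times the norms of the remaining factors does not depend on \<open>M\<close>.\<close>

lemma factor_list_times_sum_bounded:
  assumes "(s, \<phi>) \<in> set ps"
  obtains D where "\<And>M. norm (prod_list (map factor ps)
    * (\<Sum>n<M. cos (real n * \<phi>) *\<^sub>R C (real n * s))) \<le> D"
proof -
  obtain us vs where ps: "ps = us @ (s, \<phi>) # vs" using assms by (meson split_list)
  let ?U = "prod_list (map factor us)" and ?V = "prod_list (map factor vs)"
  show thesis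
  proof
    fix M
    let ?S = "\<Sum>n<M. cos (real n * \<phi>) *\<^sub>R C (real n * s)"
    have "?S * ?V = ?V * ?S"
      by (rule prod_list_commute)
        (auto simp: sum_distrib_left sum_distrib_right factor_C_commute simp del: split_paired_All)
    then have "prod_list (map factor ps) * ?S = ?U * (factor (s, \<phi>) * ?S) * ?V"
      by (simp add: ps mult.assoc)
    also have "norm \<dots> \<le> norm ?U * norm (factor (s, \<phi>) * ?S) * norm ?V"
      by (meson norm_mult_ineq mult_right_mono norm_ge_zero order_trans)
    also have "\<dots> \<le> norm ?U * (2 * K) * norm ?V"
      by (intro mult_right_mono mult_left_mono norm_factor_times_sum_le norm_ge_zero)
    finally show "norm (prod_list (map factor ps) * ?S) \<le> norm ?U * (2 * K) * norm ?V" .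
  qed
qed

text \<open>Averaging \<open>w\<close> over \<open>n < M\<close> and multiplying by the product isolates the constant
  coefficient of \<open>w\<close>.\<close>
lemma factor_list_eq_0:
  fixes coef S \<Phi> :: "'i \<Rightarrow> real" and w :: "nat \<Rightarrow> 'a"
  assumes "finite I" "i0 \<in> I" "S i0 = 0" "\<Phi> i0 = 0"
    and w: "\<And>n. w n = (\<Sum>i\<in>I. coef i *\<^sub>R (cos (real n * \<Phi> i) *\<^sub>R C (real n * S i)))"
    and w_le: "\<And>n. norm (w n) \<le> \<delta>" and \<delta>: "\<delta> < coef i0"
    and ps: "\<And>i. i \<in> I \<Longrightarrow> i \<noteq> i0 \<Longrightarrow> (S i, \<Phi> i) \<in> set ps"
  shows "prod_list (map factor ps) = 0"
proof (rule ccontr)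
  define Q where "Q = prod_list (map factor ps)"
  assume "prod_list (map factor ps) \<noteq> 0"
  then have Q: "norm Q > 0" by (simp add: Q_def)
  define A where "A i M = (\<Sum>n<M. cos (real n * \<Phi> i) *\<^sub>R C (real n * S i))" for i M
  have "\<exists>D. \<forall>M. norm (Q * A i M) \<le> D" if "i \<in> I - {i0}" for i
  proof (rule factor_list_times_sum_bounded)
    show "(S i, \<Phi> i) \<in> set ps" using ps that by auto
  qed (auto simp: Q_def A_def)
  then obtain D where D: "\<And>i M. i \<in> I - {i0} \<Longrightarrow> norm (Q * A i M) \<le> D i" by metis
  define T where "T = (\<Sum>i\<in>I - {i0}. \<bar>coef i\<bar> * D i)"
  have A0: "A i0 M = real M *\<^sub>R 1" for M
    using assms(3,4) zero by (simp add: A_def scaleR_conv_of_real)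
  \<comment> \<open>The constant term contributes \<open>M * coef i0\<close>, the norm bound on
    \<open>w\<close> at most \<open>M * \<delta>\<close>, and all other terms together at most
    \<open>T\<close>. Linear growth in \<open>M\<close> then contradicts
    \<open>Q \<noteq> 0\<close>.\<close>
  have "real M * ((coef i0 - \<delta>) * norm Q) \<le> T" for M
  proof -
    have "(\<Sum>n<M. w n) = (\<Sum>i\<in>I. coef i *\<^sub>R A i M)"
      unfolding w A_def scaleR_sum_right by (rule sum.swap)
    also have "\<dots> = coef i0 *\<^sub>R A i0 M + (\<Sum>i\<in>I - {i0}. coef i *\<^sub>R A i M)"
      using assms(1,2) by (rule sum.remove)
    finally have "(real M * coef i0) *\<^sub>R Q
        = Q * (\<Sum>n<M. w n) - (\<Sum>i\<in>I - {i0}. coef i *\<^sub>R (Q * A i M))"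
      by (simp add: A0 distrib_left sum_distrib_left mult.commute)
    then have "norm ((real M * coef i0) *\<^sub>R Q)
        \<le> norm (Q * (\<Sum>n<M. w n)) + norm (\<Sum>i\<in>I - {i0}. coef i *\<^sub>R (Q * A i M))"
      by (metis norm_triangle_ineq4)
    also have "norm (\<Sum>i\<in>I - {i0}. coef i *\<^sub>R (Q * A i M)) \<le> T"
      unfolding T_def by (rule order_trans[OF norm_sum]) (auto intro!: sum_mono mult_left_mono D)
    also have "norm (Q * (\<Sum>n<M. w n)) \<le> norm Q * (real M * \<delta>)"
    proof (rule order_trans[OF norm_mult_ineq], rule mult_left_mono)
      show "norm (\<Sum>n<M. w n) \<le> real M * \<delta>"
        using sum_norm_le[of "{..<M}" w "\<lambda>_. \<delta>"] w_le by simp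
    qed simp
    finally have *: "norm ((real M * coef i0) *\<^sub>R Q) \<le> norm Q * (real M * \<delta>) + T" by simp
    have "real M * coef i0 * norm Q \<le> norm ((real M * coef i0) *\<^sub>R Q)"
      by (simp add: mult_right_mono)
    with * show ?thesis by (simp add: algebra_simps)
  qed
  moreover obtain M where "T < real M * ((coef i0 - \<delta>) * norm Q)"
    using reals_Archimedean3[of "(coef i0 - \<delta>) * norm Q"] Q \<delta> by auto
  ultimately show False by (meson not_le)
qed

text \<open>On the eigenvector \<open>s = factor (t, \<phi>) * z\<close> the sum of \<open>norm_factor_times_sum_le\<close>
  becomes \<open>(\<Sum>n<M. (cos (n \<phi>))\<^sup>2) *\<^sub>R s\<close>, which is unbounded unless \<open>s = 0\<close>.\<close>
lemma factor_semisimple: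
  assumes "factor (t, \<phi>) * (factor (t, \<phi>) * z) = 0"
  shows "factor (t, \<phi>) * z = 0"
proof (rule ccontr)
  define s where "s = factor (t, \<phi>) * z"
  assume "factor (t, \<phi>) * z \<noteq> 0"
  then have s: "norm s > 0" by (simp add: s_def)
  have "C t * s = cos \<phi> *\<^sub>R s" using assms by (simp add: s_def factor_mult_eq_0)
  note eig = eigen_multiple[OF this]
  have le: "(\<Sum>n<M. (cos (real n * \<phi>))\<^sup>2) * norm s \<le> 2 * K * norm z" for M
  proof -
    let ?S = "\<Sum>n<M. cos (real n * \<phi>) *\<^sub>R C (real n * t)"
    have "(\<Sum>n<M. (cos (real n * \<phi>))\<^sup>2) *\<^sub>R s = ?S * s"
      by (simp add: sum_distrib_right eig scaleR_sum_left power2_eq_square)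
    also have "\<dots> = factor (t, \<phi>) * ?S * z"
      by (simp add: s_def sum_distrib_left sum_distrib_right factor_C_commute mult.assoc[symmetric])
    also have "norm \<dots> \<le> 2 * K * norm z"
      by (rule order_trans[OF norm_mult_ineq]) (intro mult_right_mono norm_factor_times_sum_le norm_ge_zero)
    finally show ?thesis by (simp add: sum_nonneg)
  qed
  have "\<exists>D. \<forall>M. real M \<le> D + 2 * (\<Sum>n<M. (cos (real n * \<phi>))\<^sup>2)"
  proof -
    have sq: "2 * (\<Sum>n<M. (cos (real n * \<phi>))\<^sup>2) = real M + (\<Sum>n<M. cos (real n * (2 * \<phi>)))" for M
    proof -
      have "2 * (cos (real n * \<phi>))\<^sup>2 = 1 + cos (real n * (2 * \<phi>))" for n
        using cos_double_cos[of "real n * \<phi>"] by (simp add: mult_ac)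
      then show ?thesis by (simp add: sum_distrib_left sum.distrib)
    qed
    show ?thesis
    proof (cases "cos (2 * \<phi>) = 1")
      case True
      interpret r: cosine_family "\<lambda>t. cos (2 * \<phi> * t)" by (rule cosine_family_cos)
      have "cos (real n * (2 * \<phi>)) = 1" for n
        using r.eigen_multiple[of 1 1 0 n] True by (simp add: mult_ac)
      then show ?thesis using sq by (intro exI[of _ 0]) simp
    next
      case False
      \<comment> \<open>The telescoping bound for this scalar family, with angle 0, bounds the sums
        of \<open>cos (2 n \<phi>)\<close>, so the sums of squares grow like
        \<open>M / 2\<close>.\<close>
      interpret r: bounded_cosine_family "\<lambda>t. cos (2 * \<phi> * t)" 1
        by (intro bounded_cosine_family.intro cosine_family_cos bounded_cosine_family_axioms.intro) simp
      have pos: "0 < \<bar>cos (2 * \<phi>) - 1\<bar>"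
        using False by (metis right_minus_eq zero_less_abs_iff)
      have "\<bar>cos (2 * \<phi>) - 1\<bar> * \<bar>\<Sum>n<M. cos (real n * (2 * \<phi>))\<bar> \<le> 2" for M
        using r.norm_factor_times_sum_le[of 1 0 M] unfolding r.factor_def
        by (simp add: abs_mult mult.commute mult.left_commute)
      then have *: "\<bar>\<Sum>n<M. cos (real n * (2 * \<phi>))\<bar> \<le> 2 / \<bar>cos (2 * \<phi>) - 1\<bar>" for M
        unfolding pos_le_divide_eq[OF pos] by (subst mult.commute)
      have "real M \<le> 2 / \<bar>cos (2 * \<phi>) - 1\<bar> + 2 * (\<Sum>n<M. (cos (real n * \<phi>))\<^sup>2)" for M
        using *[of M] sq[of M] by linarith
      then show ?thesis by blast
    qed
  qed
  then obtain D where D: "\<And>M. real M \<le> D + 2 * (\<Sum>n<M. (cos (real n * \<phi>))\<^sup>2)" by blast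
  have "real M * norm s \<le> D * norm s + 2 * (2 * K * norm z)" for M
    using mult_right_mono[OF D[of M], of "norm s"] le[of M] s by (simp add: algebra_simps)
  moreover obtain M where "D * norm s + 2 * (2 * K * norm z) < real M * norm s"
    using reals_Archimedean3[OF s] by blast
  ultimately show False by (meson not_le)
qed

end

section \<open>A finite set of frequencies\<close>

lemma central_binomial_over_power:
  assumes "r > 0"
  shows "1 / (2 * real r) \<le> real (2*r choose r) / 4 ^ r"
proof -
  have "4 ^ r / (2 * real r) \<le> real (2*r choose r)"
    using central_binomial_lower_bound[OF assms] by simp
  then show ?thesis using assms by (simp add: field_simps)
qed

text \<open>The left side decays exponentially in \<open>r\<close>, the normalised central binomial
  coefficient only like a power of \<open>r\<close>.\<close>

lemma power_less_central_binomial: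
  fixes x :: real
  assumes "0 \<le> x" "x < 1"
  obtains r where "r > 0" "x ^ r < real (2*r choose r) / 4 ^ r"
proof -
  have "(\<lambda>n. real n * x ^ n) \<longlonglongrightarrow> 0"
    using powser_times_n_limit_0[of x] assms by simp
  then have "\<forall>\<^sub>F n in sequentially. real n * x ^ n < 1/2"
    by (rule order_tendstoD) simp
  moreover have "\<forall>\<^sub>F n::nat in sequentially. n > 0" by (rule eventually_gt_at_top)
  ultimately have "\<forall>\<^sub>F n in sequentially. real n * x ^ n < 1/2 \<and> n > 0"
    by (rule eventually_conj)
  then obtain r where r: "real r * x ^ r < 1/2" "r > 0"
    by (auto dest: eventually_happens)
  then have "x ^ r < 1 / (2 * real r)" by (simp add: field_simps)
  then show thesis using that[of r] r(2) central_binomial_over_power[of r] by linarith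
qed

context bounded_cosine_family
begin

text \<open>The alternating sequence \<open>(-1) ^ i * C (i x)\<close> satisfies the same recurrence
  and takes the value \<open>- C x\<close> at \<open>i = 1\<close>.\<close>

lemma half_minus_power:
  "((1/2) *\<^sub>R (1 - C x)) ^ r
    = (\<Sum>l\<le>2*r. (real (2*r choose l) / 4 ^ r * (if even (int l - int r) then 1 else -1))
        *\<^sub>R C (real_of_int (int l - int r) * x))"
proof -
  define D where "D i = (if even i then 1 else -1) *\<^sub>R C (real_of_int i * x)" for i :: int
  have "D (i + 1) + D (i - 1) = 2 * (D i * D 1)" for i
    using dAlembert[of "real_of_int i * x" x]
    by (cases "even i") (simp_all add: D_def algebra_simps)
  then have "((1/2) *\<^sub>R (1 + D 1)) ^ r
    = (\<Sum>k\<le>2*r. (real (2*r choose k) / 4 ^ r) *\<^sub>R D (int k - int r))"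
    by (intro half_plus_cosine_power) (simp_all add: D_def zero)
  then show ?thesis by (simp add: D_def)
qed

text \<open>Expanding both powers gives a double sum indexed by \<open>(k, l)\<close>. The index
  \<open>(r1, r2)\<close> is the constant term, and its coefficient is the product of the two
  normalised central binomial coefficients.\<close>

lemma kernel_factor_list_eq_0:
  fixes a \<tau> :: real
  assumes le: "\<And>n. norm (((1/2) * (1 + cos (real n * (a * \<tau>)))) ^ r1
        *\<^sub>R ((1/2) *\<^sub>R (1 - C (real n * \<tau>))) ^ r2) \<le> \<delta>"
    and \<delta>: "\<delta> < (real (2*r1 choose r1) / 4 ^ r1) * (real (2*r2 choose r2) / 4 ^ r2)"
    and ps: "\<And>k l. k \<le> 2*r1 \<Longrightarrow> l \<le> 2*r2 \<Longrightarrow> (k, l) \<noteq> (r1, r2) \<Longrightarrow>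
      (real_of_int (int l - int r2) * \<tau>, real_of_int (int k - int r1) * (a * \<tau>)) \<in> set ps"
  shows "prod_list (map factor ps) = 0"
proof -
  define S :: "nat \<times> nat \<Rightarrow> real" where "S = (\<lambda>(k, l). real_of_int (int l - int r2) * \<tau>)"
  define \<Phi> :: "nat \<times> nat \<Rightarrow> real" where "\<Phi> = (\<lambda>(k, l). real_of_int (int k - int r1) * (a * \<tau>))"
  define \<alpha> where "\<alpha> k = real (2*r1 choose k) / 4 ^ r1" for k
  define \<beta> where "\<beta> l = real (2*r2 choose l) / 4 ^ r2 * (if even (int l - int r2) then 1 else -1)" for l
  define coef :: "nat \<times> nat \<Rightarrow> real" where "coef = (\<lambda>(k, l). \<alpha> k * \<beta> l)"
  define w where "w n = ((1/2) * (1 + cos (real n * (a * \<tau>)))) ^ r1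
        *\<^sub>R ((1/2) *\<^sub>R (1 - C (real n * \<tau>))) ^ r2" for n
  \<comment> \<open>\<open>\<Phi>\<close> depends only on the first index and \<open>S\<close> only
    on the second, so \<open>l\<close> here and \<open>k\<close> in \<open>K2\<close> are dummies
    that make the two sums fit into one over pairs.\<close>
  have K1: "((1/2) * (1 + cos (real n * (a * \<tau>)))) ^ r1
      = (\<Sum>k\<le>2*r1. \<alpha> k * cos (real n * \<Phi> (k, l)))" for n l
  proof -
    have "((1/2) *\<^sub>R (1 + cos (real_of_int 1 * (real n * (a * \<tau>))))) ^ r1
      = (\<Sum>k\<le>2*r1. (real (2*r1 choose k) / 4 ^ r1) *\<^sub>R cos (real_of_int (int k - int r1) * (real n * (a * \<tau>))))"
      by (rule half_plus_cosine_power) (simp_all add: cos_times_cos distrib_right left_diff_distrib)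
    then show ?thesis by (simp add: \<alpha>_def \<Phi>_def mult_ac)
  qed
  have K2: "((1/2) *\<^sub>R (1 - C (real n * \<tau>))) ^ r2 = (\<Sum>l\<le>2*r2. \<beta> l *\<^sub>R C (real n * S (k, l)))" for n k
    unfolding half_minus_power by (simp add: \<beta>_def S_def mult_ac)
  have "w n = (\<Sum>k\<le>2*r1. \<Sum>l\<le>2*r2. coef (k, l) *\<^sub>R (cos (real n * \<Phi> (k, l)) *\<^sub>R C (real n * S (k, l))))" for n
  proof -
    have "w n = (\<Sum>k\<le>2*r1. (\<alpha> k * cos (real n * \<Phi> (k, 0))) *\<^sub>R ((1/2) *\<^sub>R (1 - C (real n * \<tau>))) ^ r2)"
      unfolding w_def K1[of n 0] scaleR_sum_left ..
    also have "\<dots> = (\<Sum>k\<le>2*r1. \<Sum>l\<le>2*r2.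
        (\<alpha> k * cos (real n * \<Phi> (k, 0))) *\<^sub>R (\<beta> l *\<^sub>R C (real n * S (k, l))))"
      by (rule sum.cong[OF refl], subst K2, rule scaleR_sum_right)
    also have "\<dots> = (\<Sum>k\<le>2*r1. \<Sum>l\<le>2*r2.
        coef (k, l) *\<^sub>R (cos (real n * \<Phi> (k, l)) *\<^sub>R C (real n * S (k, l))))"
      by (intro sum.cong refl) (simp add: coef_def \<Phi>_def mult_ac)
    finally show ?thesis .
  qed
  then have w: "w n = (\<Sum>i\<in>{..2*r1} \<times> {..2*r2}. coef i *\<^sub>R (cos (real n * \<Phi> i) *\<^sub>R C (real n * S i)))" for n
    by (simp add: sum.cartesian_product case_prod_unfold)
  have le': "norm (w n) \<le> \<delta>" for n unfolding w_def by (rule le)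
  show ?thesis
  proof (rule factor_list_eq_0[OF _ _ _ _ w le', of "(r1, r2)"])
    fix i assume "i \<in> {..2*r1} \<times> {..2*r2}" "i \<noteq> (r1, r2)"
    then show "(S i, \<Phi> i) \<in> set ps" using ps by (cases i) (auto simp: S_def \<Phi>_def)
  qed (use \<delta> in \<open>auto simp: S_def \<Phi>_def coef_def \<alpha>_def \<beta>_def\<close>)
qed

text \<open>With \<open>c = cos (a t)\<close> the base has norm at most
  \<open>(1 + c) * (1 - c + m) / 4\<close>, a product of factors with constant sum
  \<open>2 + m\<close>. For \<open>a = 0\<close> a positive \<open>r1\<close> would produce further
  constant terms, so that case uses \<open>r1 = 0\<close> and the bound \<open>m / 2\<close> on the
  second factor.\<close>

lemma kernel_exponents:
  assumes close: "\<And>t. norm (C t - cos (a * t) *\<^sub>R 1) \<le> m" and "m < 2"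
  obtains r1 r2 \<delta> where "\<delta> < (real (2*r1 choose r1) / 4 ^ r1) * (real (2*r2 choose r2) / 4 ^ r2)"
    and "a = 0 \<Longrightarrow> r1 = 0"
    and "\<And>t. norm (((1/2) * (1 + cos (a * t))) ^ r1 *\<^sub>R ((1/2) *\<^sub>R (1 - C t)) ^ r2) \<le> \<delta>"
proof -
  have m: "0 \<le> m" using close[of 0] norm_ge_zero order_trans by blast
  define x where "x = (1 + m/2) / 2"
  have x: "0 \<le> x" "x < 1" using m \<open>m < 2\<close> by (auto simp: x_def)
  then obtain r where r: "r > 0" "x ^ r < real (2*r choose r) / 4 ^ r"
    by (rule power_less_central_binomial)
  have one_minus: "norm (1 - C t) \<le> 1 - cos (a * t) + m" for t
  proof -
    have "1 - C t = (1 - cos (a * t)) *\<^sub>R 1 - (C t - cos (a * t) *\<^sub>R 1)"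
      by (simp add: scaleR_left_diff_distrib)
    then have "norm (1 - C t) \<le> norm ((1 - cos (a * t)) *\<^sub>R (1::'a)) + norm (C t - cos (a * t) *\<^sub>R 1)"
      by (metis norm_triangle_ineq4)
    then show ?thesis using close[of t] by simp
  qed
  show thesis
  proof (cases "a = 0")
    case True
    show thesis
    proof (rule that[of "x ^ r" 0 r])
      fix t
      have "norm ((1/2) *\<^sub>R (1 - C t)) \<le> x"
        using one_minus[of t] True \<open>m < 2\<close> by (simp add: x_def)
      then have "norm (((1/2) *\<^sub>R (1 - C t)) ^ r) \<le> x ^ r"
        by (meson norm_power_ineq power_mono norm_ge_zero order_trans)
      then show "norm (((1/2) * (1 + cos (a * t))) ^ 0 *\<^sub>R ((1/2) *\<^sub>R (1 - C t)) ^ r) \<le> x ^ r"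
        by simp
    qed (use r in auto)
  next
    case False
    show thesis
    proof (rule that[of "x ^ r * x ^ r" r r])
      show "x ^ r * x ^ r < (real (2*r choose r) / 4 ^ r) * (real (2*r choose r) / 4 ^ r)"
        using x r by (intro mult_strict_mono') auto
      fix t
      define c where "c = cos (a * t)"
      have c: "-1 \<le> c" "c \<le> 1" by (auto simp: c_def)
      have "norm (((1/2) * (1 + c)) *\<^sub>R ((1/2) *\<^sub>R (1 - C t))) = (1 + c) * norm (1 - C t) / 4"
        using c by simp
      also have "\<dots> \<le> (1 + c) * (1 - c + m) / 4"
        using one_minus[of t] c unfolding c_def[symmetric]
        by (intro divide_right_mono mult_left_mono) auto
      also have "\<dots> \<le> x * x"
        \<comment> \<open>The right side exceeds the left by \<open>(c - m/2)^2 / 4\<close>.\<close>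
        using zero_le_power2[of "c - m/2"] by (simp add: x_def power2_eq_square field_simps)
      finally have "norm ((((1/2) * (1 + c)) *\<^sub>R ((1/2) *\<^sub>R (1 - C t))) ^ r) \<le> (x * x) ^ r"
        by (meson norm_power_ineq power_mono norm_ge_zero order_trans)
      then show "norm (((1/2) * (1 + cos (a * t))) ^ r *\<^sub>R ((1/2) *\<^sub>R (1 - C t)) ^ r) \<le> x ^ r * x ^ r"
        unfolding c_def by (simp only: scaleR_power power_mult_distrib)
    qed (use False in auto)
  qed
qed

lemma annihilating_list_nonzero:
  assumes close: "\<And>t. norm (C t - cos (a * t) *\<^sub>R 1) \<le> m" and "m < 2"
  obtains bs where "\<And>b. b \<in> set bs \<Longrightarrow> 0 \<le> b"
    and "\<And>t. t \<noteq> 0 \<Longrightarrow> prod_list (map (\<lambda>b. factor (t, b * t)) bs) = 0"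
proof (rule kernel_exponents[OF assms])
  fix r1 r2 \<delta> assume \<delta>: "\<delta> < (real (2*r1 choose r1) / 4 ^ r1) * (real (2*r2 choose r2) / 4 ^ r2)"
    and r1: "a = 0 \<Longrightarrow> r1 = 0"
    and le: "\<And>t. norm (((1/2) * (1 + cos (a * t))) ^ r1 *\<^sub>R ((1/2) *\<^sub>R (1 - C t)) ^ r2) \<le> \<delta>"
  define idx where "idx = filter (\<lambda>i. i \<noteq> (r1, r2)) (List.product [0..<2*r1+1] [0..<2*r2+1])"
  have idx: "(k, l) \<in> set idx \<longleftrightarrow> k \<le> 2*r1 \<and> l \<le> 2*r2 \<and> (k, l) \<noteq> (r1, r2)" for k l
    by (auto simp: idx_def)
  \<comment> \<open>A factor at \<open>(k, l)\<close> relates the argument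
    \<open>(l - r2) * \<tau>\<close> to the angle \<open>(k - r1) * a * \<tau>\<close>; this is the
    modulus of their quotient, free of \<open>\<tau>\<close>. Indices with \<open>l = r2\<close> are
    filtered out below.\<close>
  define \<beta> :: "nat \<times> nat \<Rightarrow> real" where "\<beta> = (\<lambda>(k, l). \<bar>a\<bar> * \<bar>real k - real r1\<bar> / \<bar>real l - real r2\<bar>)"
  define bs where "bs = map \<beta> (filter (\<lambda>i. snd i \<noteq> r2) idx)"
  show thesis
  proof (rule that[of bs])
    show "0 \<le> b" if "b \<in> set bs" for b
      using that by (auto simp: bs_def \<beta>_def)
    fix t :: real assume t: "t \<noteq> 0"
    \<comment> \<open>Chosen so that every angle \<open>(k - r1) * a * \<tau>\<close> has modulus
      below \<open>2 * pi\<close>; a nonzero one then has cosine different from 1.\<close>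
    obtain N :: nat where N: "real r1 * \<bar>a\<bar> * \<bar>t\<bar> < real N * (2 * pi)"
      using reals_Archimedean3[of "2 * pi"] by auto
    have "N > 0" using N by (intro Nat.gr0I) (auto simp: mult_less_0_iff not_less)
    \<comment> \<open>The factorial makes \<open>L\<close> divisible by every nonzero
      \<open>\<bar>l - r2\<bar>\<close>.\<close>
    define L where "L = fact r2 * N"
    have L: "real L > 0" "real L \<ge> real N"
      using \<open>N > 0\<close> by (auto simp: L_def fact_ge_1)
    define \<tau> where "\<tau> = t / real L"
    have \<tau>: "\<tau> \<noteq> 0" "real L * \<tau> = t" using t L by (auto simp: \<tau>_def)
    have small: "real r1 * \<bar>a\<bar> * \<bar>\<tau>\<bar> < 2 * pi"
    proof -
      have "real r1 * \<bar>a\<bar> * \<bar>t\<bar> < real L * (2 * pi)"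
        using N L(2) by (meson less_le_trans mult_right_mono pi_ge_zero mult_nonneg_nonneg zero_le_numeral)
      then show ?thesis using L(1) by (simp add: \<tau>_def field_simps)
    qed
    define f where "f = (\<lambda>(k, l). factor (real_of_int (int l - int r2) * \<tau>, real_of_int (int k - int r1) * (a * \<tau>)))"
    \<comment> \<open>A factor with \<open>l = r2\<close> is a scalar
      \<open>1 - cos \<theta>\<close>, shown below to be nonzero, and may be replaced by 1.\<close>
    define g where "g i = (if snd i \<noteq> r2 then factor (t, \<beta> i * t) else 1)" for i
    have "prod_list (map factor (map (\<lambda>(k, l).
        (real_of_int (int l - int r2) * \<tau>, real_of_int (int k - int r1) * (a * \<tau>))) idx)) = 0"
    proof (rule kernel_factor_list_eq_0[OF _ \<delta>])
      show "norm (((1/2) * (1 + cos (real n * (a * \<tau>)))) ^ r1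
        *\<^sub>R ((1/2) *\<^sub>R (1 - C (real n * \<tau>))) ^ r2) \<le> \<delta>" for n
        using le[of "real n * \<tau>"] by (simp add: mult_ac)
    qed (use idx in force)
    then have "prod_list (map f idx) * 1 = 0"
      by (simp add: f_def case_prod_unfold comp_def)
    then have "prod_list (map g idx) * 1 = 0"
    proof (rule prod_list_transfer_annihilation[rotated -1])
      show "f x * g y = g y * f x" for x y
        by (auto simp: f_def g_def factor_commute split: prod.split)
      show "g x * g y = g y * g x" for x y
        by (auto simp: g_def factor_commute)
      fix x w assume x: "x \<in> set idx" and fw: "f x * w = 0"
      obtain k l where kl: "x = (k, l)" by (cases x)
      have eig: "C (real_of_int (int l - int r2) * \<tau>) * w = cos (real_of_int (int k - int r1) * (a * \<tau>)) *\<^sub>R w"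
        using fw by (simp add: f_def kl factor_mult_eq_0)
      show "g x * w = 0"
      proof (cases "l = r2")
        case True
        define \<theta> where "\<theta> = real_of_int (int k - int r1) * (a * \<tau>)"
        have k: "k \<noteq> r1" "k \<le> 2*r1" using x True by (auto simp: kl idx)
        then have "a \<noteq> 0" using r1 by auto
        then have "\<theta> \<noteq> 0" using \<tau> k by (simp add: \<theta>_def)
        have "\<bar>\<theta>\<bar> \<le> real r1 * \<bar>a\<bar> * \<bar>\<tau>\<bar>"
        proof -
          have "\<bar>real_of_int (int k - int r1)\<bar> \<le> real r1" using k(2) by simp
          then show ?thesis
            by (simp add: \<theta>_def abs_mult mult.assoc mult_right_mono)
        qed
        then have "\<bar>\<theta>\<bar> < 2 * pi" using small by simp
        have "cos \<theta> \<noteq> 1"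
        proof
          assume "cos \<theta> = 1"
          then obtain n :: int where n: "\<theta> = real_of_int n * 2 * pi" using cos_one_2pi_int by blast
          then have "\<bar>real_of_int n\<bar> * (2 * pi) < 1 * (2 * pi)"
            using \<open>\<bar>\<theta>\<bar> < 2 * pi\<close> by (simp add: abs_mult)
          then have "\<bar>real_of_int n\<bar> < 1" by (rule mult_right_less_imp_less) simp
          then have "n = 0" by linarith
          then show False using n \<open>\<theta> \<noteq> 0\<close> by simp
        qed
        moreover have "(1 - cos \<theta>) *\<^sub>R w = 0"
          using eig True zero by (simp add: \<theta>_def scaleR_left_diff_distrib)
        ultimately have "w = 0" by simp
        then show ?thesis by simp
      next
        case False
        \<comment> \<open>Evenness of \<open>C\<close> removes the sign of \<open>l - r2\<close>;
          multiplying the argument \<open>d * \<tau>\<close> by \<open>q = L / d\<close> then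
          reaches \<open>t\<close>.\<close>
        define d where "d = nat \<bar>int l - int r2\<bar>"
        have d: "real d = \<bar>real_of_int (int l - int r2)\<bar>" "d > 0" "d \<le> r2"
          using False x by (auto simp: d_def kl idx)
        then have "d dvd L" by (simp add: L_def dvd_fact)
        then obtain q where q: "L = d * q" by blast
        have "C (real_of_int (int l - int r2) * \<tau>) = C (real d * \<tau>)"
          unfolding d(1) by (subst (1 2) abs_arg[symmetric]) (simp add: abs_mult)
        then have "C (real q * (real d * \<tau>)) * w = cos (real q * (real_of_int (int k - int r1) * (a * \<tau>))) *\<^sub>R w"
          using eig by (intro eigen_multiple) simp
        moreover have "real q * (real d * \<tau>) = t" using \<tau>(2) q by (simp add: mult_ac)
        moreover have "cos (real q * (real_of_int (int k - int r1) * (a * \<tau>))) = cos (\<beta> x * t)"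
        proof -
          have "real d > 0" using d(2) by simp
          have "\<tau> * real q = t / real d" using \<tau>(2) q \<open>real d > 0\<close> by (simp add: field_simps)
          then have "real q * \<bar>\<tau>\<bar> = \<bar>t\<bar> / real d"
            by (metis abs_divide abs_mult abs_of_nat mult.commute)
          moreover have "\<bar>real q * (real_of_int (int k - int r1) * (a * \<tau>))\<bar>
              = \<bar>a\<bar> * \<bar>real k - real r1\<bar> * (real q * \<bar>\<tau>\<bar>)"
            by (simp add: abs_mult)
          moreover have "\<bar>\<beta> x * t\<bar> = \<bar>a\<bar> * \<bar>real k - real r1\<bar> * (\<bar>t\<bar> / real d)"
            using d(1) by (simp add: \<beta>_def kl abs_mult)
          ultimately have "\<bar>real q * (real_of_int (int k - int r1) * (a * \<tau>))\<bar> = \<bar>\<beta> x * t\<bar>"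
            by simp
          then show ?thesis by (metis cos_abs_real)
        qed
        ultimately show ?thesis using False by (simp add: g_def kl factor_mult_eq_0)
      qed
    qed
    moreover have "prod_list (map g xs) = prod_list (map (\<lambda>b. factor (t, b * t)) (map \<beta> (filter (\<lambda>i. snd i \<noteq> r2) xs)))" for xs
      by (induction xs) (auto simp: g_def)
    ultimately show "prod_list (map (\<lambda>b. factor (t, b * t)) bs) = 0"
      by (simp add: bs_def)
  qed
qed

text \<open>Semisimplicity allows each frequency to be kept only once. At \<open>t = 0\<close> every
  factor vanishes, so it suffices that the list is nonempty, which holds because the empty product
  is 1.\<close>

lemma annihilating_list:
  assumes "\<And>t. norm (C t - cos (a * t) *\<^sub>R 1) \<le> m" and "m < 2"
  obtains bs where "distinct bs" and "\<And>b. b \<in> set bs \<Longrightarrow> 0 \<le> b"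
    and "\<And>t. prod_list (map (\<lambda>b. C t - cos (b * t) *\<^sub>R 1) bs) = 0"
proof -
  obtain bs where bs: "\<And>b. b \<in> set bs \<Longrightarrow> 0 \<le> b"
    and ann: "\<And>t. t \<noteq> 0 \<Longrightarrow> prod_list (map (\<lambda>b. factor (t, b * t)) bs) = 0"
    using annihilating_list_nonzero[OF assms] by blast
  show thesis
  proof (rule that[of "remdups bs"])
    fix t
    show "prod_list (map (\<lambda>b. C t - cos (b * t) *\<^sub>R 1) (remdups bs)) = 0"
    proof (cases "t = 0")
      case True
      have "remdups bs \<noteq> []" using ann[of 1] by auto
      then show ?thesis using zero True by (cases "remdups bs") auto
    next
      case False
      have "prod_list (map (\<lambda>b. factor (t, b * t)) (remdups bs)) * 1 = 0"
        by (rule prod_list_remdups_annihilation)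
          (use ann[OF False] in \<open>auto simp: factor_commute intro: factor_semisimple\<close>)
      then show ?thesis by (simp add: factor_def)
    qed
  qed (use bs in auto)
qed

end

section \<open>Joint eigenvectors\<close>

context cosine_family
begin

lemma mult_commute_C: "C s * (C t * w) = C t * (C s * w)"
  by (metis commute mult.assoc)

lemma subspace_eigen: "subspace {w. \<forall>u\<in>U. C u * w = c u *\<^sub>R w}"
  by (auto simp: subspace_def distrib_left scaleR_right_distrib)

text \<open>\<open>C (t - u)\<close> and \<open>C (t + u)\<close> have sum
  \<open>2 * C t * C u\<close> and product \<open>(C (2 t) + C (2 u)) / 2\<close>. On
  \<open>z\<close> both become scalars, namely the coefficients of a quadratic with roots
  \<open>cos (\<alpha> \<plusminus> \<beta>)\<close>.\<close>

lemma joint_eigen_quadratic: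
  assumes t: "C t * z = cos \<alpha> *\<^sub>R z" and u: "C u * z = cos \<beta> *\<^sub>R z"
  shows "(C (t - u) - cos (\<alpha> - \<beta>) *\<^sub>R 1) * ((C (t - u) - cos (\<alpha> + \<beta>) *\<^sub>R 1) * z) = 0"
proof -
  let ?v = "C (t - u)"
  have t2: "C (2 * t) * z = cos (2 * \<alpha>) *\<^sub>R z" using eigen_multiple[OF t, of 2] by simp
  have u2: "C (2 * u) * z = cos (2 * \<beta>) *\<^sub>R z" using eigen_multiple[OF u, of 2] by simp
  have "C (t + u) = 2 *\<^sub>R (C t * C u) - ?v" by (simp add: mult_eq)
  then have "C (t + u) * z = 2 *\<^sub>R (C t * (C u * z)) - ?v * z"
    by (simp add: left_diff_distrib mult.assoc)
  also have "\<dots> = (2 * cos \<alpha> * cos \<beta>) *\<^sub>R z - ?v * z" by (simp add: t u mult_ac)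
  also have "2 * cos \<alpha> * cos \<beta> = cos (\<alpha> - \<beta>) + cos (\<alpha> + \<beta>)" using cos_times_cos[of \<alpha> \<beta>] by simp
  finally have "?v * (C (t + u) * z) = (cos (\<alpha> - \<beta>) + cos (\<alpha> + \<beta>)) *\<^sub>R (?v * z) - ?v * (?v * z)"
    by (simp add: right_diff_distrib)
  moreover have "?v * (C (t + u) * z) = (cos (\<alpha> - \<beta>) * cos (\<alpha> + \<beta>)) *\<^sub>R z"
  proof -
    have "?v * C (t + u) = (1/2) *\<^sub>R (C (2 * t) + C (2 * u))"
      using minus[of "2 * u"] by (simp add: mult_eq algebra_simps)
    then have "?v * (C (t + u) * z) = (1/2) *\<^sub>R (C (2 * t) * z + C (2 * u) * z)"
      by (simp add: mult.assoc[symmetric] distrib_right)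
    also have "\<dots> = ((cos (2 * \<alpha>) + cos (2 * \<beta>)) / 2) *\<^sub>R z"
      unfolding t2 u2 by (simp add: scaleR_left_distrib scaleR_right_distrib add_divide_distrib)
    also have "(cos (2 * \<alpha>) + cos (2 * \<beta>)) / 2 = cos (\<alpha> - \<beta>) * cos (\<alpha> + \<beta>)"
      using cos_times_cos[of "\<alpha> + \<beta>" "\<alpha> - \<beta>"] by (simp add: mult_ac add_ac)
    finally show ?thesis .
  qed
  ultimately show ?thesis by (simp add: algebra_simps)
qed

lemma eigen_rational_multiple:
  assumes "\<And>n. n > 0 \<Longrightarrow> C (s / real n) * w = cos (b * (s / real n)) *\<^sub>R w"
    and "q \<in> \<rat>" "0 \<le> q"
  shows "C (q * s) * w = cos (b * (q * s)) *\<^sub>R w"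
proof -
  obtain k n :: nat where "n \<noteq> 0" "\<bar>q\<bar> = real k / real n" using Rats_abs_nat_div_natE[OF assms(2)] by metis
  then show ?thesis
    using eigen_multiple[OF assms(1)[of n], of k] assms(3) by (simp add: mult_ac)
qed

text \<open>The \<open>p b\<close> come from splitting 1 by \<open>C t0\<close>. Their frequency is
  then confirmed at \<open>t0 / n\<close>, at nonnegative rational multiples of \<open>t0\<close>,
  on the interval from 0 to \<open>t0\<close>, and at all reals. Where a new \<open>C t\<close>
  enters, \<open>p b\<close> is split inside the eigenspace already known, and only the component
  with frequency \<open>b\<close> survives.\<close>

lemma eigen_decomposition:
  assumes bs: "distinct bs" "\<And>b. b \<in> set bs \<Longrightarrow> 0 \<le> b"
    and ann: "\<And>t. prod_list (map (\<lambda>b. C t - cos (b * t) *\<^sub>R 1) bs) = 0"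
    and S: "subspace S" "\<And>t w. w \<in> S \<Longrightarrow> C t * w \<in> S" "1 \<in> S"
  obtains p where "(\<Sum>b\<in>set bs. p b) = 1" "\<And>b. b \<in> set bs \<Longrightarrow> p b \<in> S"
    "\<And>b t. b \<in> set bs \<Longrightarrow> C t * p b = cos (b * t) *\<^sub>R p b"
proof -
  \<comment> \<open>Small enough that \<open>b * t0 < pi\<close> for all frequencies, so that
    \<open>cos\<close> separates them at every positive \<open>t \<le> t0\<close>.\<close>
  define t0 where "t0 = pi / (1 + (\<Sum>b\<in>set bs. b))"
  have "0 \<le> (\<Sum>b\<in>set bs. b)" by (simp add: bs(2) sum_nonneg)
  then have t0: "0 < t0" by (simp add: t0_def)
  have t0_less: "b * t0 < pi" if "b \<in> set bs" for b
  proof -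
    have "b \<le> (\<Sum>b\<in>set bs. b)" using that bs(2) by (intro member_le_sum) auto
    then have "b < 1 + (\<Sum>b\<in>set bs. b)" by simp
    then have "b * pi < (1 + (\<Sum>b\<in>set bs. b)) * pi" by simp
    then show ?thesis using \<open>0 \<le> (\<Sum>b\<in>set bs. b)\<close> by (simp add: t0_def field_simps)
  qed
  have t_less: "b * t < pi" if "b \<in> set bs" "t \<le> t0" for b t
    using t0_less[OF that(1)] mult_left_mono[OF that(2) bs(2)[OF that(1)]] by linarith
  have inj: "inj_on (\<lambda>b. cos (b * t)) (set bs)" if t: "0 < t" "t \<le> t0" for t
  proof (rule inj_onI)
    fix b c assume bc: "b \<in> set bs" "c \<in> set bs" and "cos (b * t) = cos (c * t)"
    moreover have "0 \<le> d * t" "d * t \<le> pi" if "d \<in> set bs" for d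
      using t_less[OF that t(2)] bs(2)[OF that] t by simp_all
    ultimately have "b * t = c * t" using cos_inj_pi by blast
    then show "b = c" using t by simp
  qed
  note splitting = eigen_splitting[OF bs(1) inj]
  obtain p where sum: "1 = (\<Sum>b\<in>set bs. p b)" and pS: "\<And>b. b \<in> set bs \<Longrightarrow> p b \<in> S"
    and p0: "\<And>b. b \<in> set bs \<Longrightarrow> C t0 * p b = cos (b * t0) *\<^sub>R p b"
    using splitting[OF t0 order_refl S(1) S(2)[where t = t0] S(3)] ann[of t0] by auto

  have frac: "C (t0 / real n) * p b = cos (b * (t0 / real n)) *\<^sub>R p b"
    if b: "b \<in> set bs" and n: "n > 0" for b n
  proof -
    let ?t = "t0 / real n"
    let ?S = "{w. \<forall>u\<in>{t0}. C u * w = cos (b * u) *\<^sub>R w}"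
    have "0 < ?t" "?t \<le> t0" using t0 n by (auto simp: divide_le_eq)
    moreover have "C ?t * w \<in> ?S" if "w \<in> ?S" for w
      using that by (auto simp: mult_commute_C[of t0])
    ultimately obtain \<zeta> where \<zeta>: "p b = (\<Sum>c\<in>set bs. \<zeta> c)"
      "\<And>c. c \<in> set bs \<Longrightarrow> C t0 * \<zeta> c = cos (b * t0) *\<^sub>R \<zeta> c"
      "\<And>c. c \<in> set bs \<Longrightarrow> C ?t * \<zeta> c = cos (c * ?t) *\<^sub>R \<zeta> c"
      using splitting[of ?t ?S "C ?t" "p b"] subspace_eigen[of "{t0}" "\<lambda>u. cos (b * u)"] p0[OF b] ann[of ?t] by auto
    \<comment> \<open>A component with another frequency would have two different eigenvalues under
      \<open>C t0\<close>.\<close>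
    have "\<zeta> c = 0" if c: "c \<in> set bs - {b}" for c
    proof -
      have "C (real n * ?t) * \<zeta> c = cos (real n * (c * ?t)) *\<^sub>R \<zeta> c"
        by (rule eigen_multiple) (use \<zeta>(3) c in auto)
      then have "cos (c * t0) *\<^sub>R \<zeta> c = cos (b * t0) *\<^sub>R \<zeta> c" using \<zeta>(2)[of c] c n by simp
      moreover have "cos (c * t0) \<noteq> cos (b * t0)"
        using inj[OF t0 order_refl] b c by (auto simp: inj_on_def)
      ultimately show ?thesis by (simp only: scaleR_cancel_right) simp
    qed
    then have "p b = \<zeta> b" unfolding \<zeta>(1) using b by (simp add: sum.remove[of _ b])
    then show ?thesis using \<zeta>(3)[OF b] by simp
  qed

  have small: "C t * p b = cos (b * t) *\<^sub>R p b" if b: "b \<in> set bs" and t: "0 < t" "t < t0" for b t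
  proof -
    define U where "U = {q * t0 | q. q \<in> \<rat> \<and> 0 \<le> q}"
    let ?S = "{w. \<forall>u\<in>U. C u * w = cos (b * u) *\<^sub>R w}"
    have "p b \<in> ?S"
      using eigen_rational_multiple[OF frac[OF b]] by (auto simp: U_def)
    moreover have "C t * w \<in> ?S" if "w \<in> ?S" for w
      using that by (auto simp: mult_commute_C[of _ t])
    ultimately obtain \<zeta> where \<zeta>: "p b = (\<Sum>c\<in>set bs. \<zeta> c)"
      "\<And>c u. c \<in> set bs \<Longrightarrow> u \<in> U \<Longrightarrow> C u * \<zeta> c = cos (b * u) *\<^sub>R \<zeta> c"
      "\<And>c. c \<in> set bs \<Longrightarrow> C t * \<zeta> c = cos (c * t) *\<^sub>R \<zeta> c"
      using splitting[of t ?S "C t" "p b"] t subspace_eigen[of U "\<lambda>u. cos (b * u)"] ann[of t] by auto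
    have "\<zeta> c = 0" if c: "c \<in> set bs - {b}" for c
    proof -
      have ne: "cos (c * t + \<sigma> * (b * t)) \<noteq> cos 0" if \<sigma>: "\<bar>\<sigma>\<bar> = 1" for \<sigma> :: real
      proof
        assume "cos (c * t + \<sigma> * (b * t)) = cos 0"
        then obtain k :: int where k: "c * t + \<sigma> * (b * t) = real_of_int k * (2 * pi)"
          using cos_one_2pi_int[of "c * t + \<sigma> * (b * t)"] by (auto simp: mult_ac)
        have "0 \<le> c * t" "c * t < pi" "0 \<le> b * t" "b * t < pi"
          using t_less[of c t] t_less[of b t] b c bs(2) t by auto
        then have "\<bar>c * t + \<sigma> * (b * t)\<bar> < 2 * pi" using \<sigma> by (auto simp: abs_if split: if_splits)
        then have "\<bar>real_of_int k\<bar> * (2 * pi) < 1 * (2 * pi)" unfolding k by (simp add: abs_mult)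
        then have "\<bar>real_of_int k\<bar> < 1" by (rule mult_right_less_imp_less) simp
        then have "k = 0" by linarith
        then have "(c + \<sigma> * b) * t = 0" using k by (simp add: algebra_simps)
        then have "c + \<sigma> * b = 0" using t by simp
        then show False using \<sigma> bs(2)[OF b] bs(2)[of c] c by (auto simp: abs_if split: if_splits)
      qed
      \<comment> \<open>As \<open>u\<close> tends to \<open>t\<close>, the right side tends to 1 and
        the left side to a limit that \<open>ne\<close> keeps away from 1. Only the scalar cosine is
        used continuously.\<close>
      have ev: "\<forall>\<^sub>F u in at_left t. cos (c * t + \<sigma> * (b * u)) \<noteq> cos (d * (t - u))"
        if "\<bar>\<sigma>\<bar> = 1" for \<sigma> d :: real
      proof -
        have "((\<lambda>u. cos (c * t + \<sigma> * (b * u)) - cos (d * (t - u)))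
            \<longlongrightarrow> cos (c * t + \<sigma> * (b * t)) - cos (d * (t - t))) (at_left t)"
          by (intro tendsto_intros)
        then have "\<forall>\<^sub>F u in at_left t. cos (c * t + \<sigma> * (b * u)) - cos (d * (t - u)) \<noteq> 0"
          by (rule tendsto_imp_eventually_ne) (use ne[OF that] in simp)
        then show ?thesis by (simp only: right_minus_eq)
      qed
      have "\<forall>\<^sub>F u in at_left t. \<forall>d\<in>set bs. cos (d * (t - u)) \<noteq> cos (c * t - b * u)
          \<and> cos (d * (t - u)) \<noteq> cos (c * t + b * u)"
        using ev[of "-1"] ev[of 1]
        by (intro eventually_ball_finite ballI eventually_conj) (auto simp: eq_commute)
      then obtain l where l: "l < t" "\<And>u d. l < u \<Longrightarrow> u < t \<Longrightarrow> d \<in> set bs \<Longrightarrow>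
          cos (d * (t - u)) \<noteq> cos (c * t - b * u) \<and> cos (d * (t - u)) \<noteq> cos (c * t + b * u)"
        unfolding eventually_at_left[OF t(1)] by blast
      \<comment> \<open>Rational density gives a point of \<open>U\<close> just below
        \<open>t\<close>, where the quadratic and the annihilating product have no common
        root.\<close>
      have "max 0 l / t0 < t / t0" using l(1) t t0 by (simp add: divide_strict_right_mono)
      then obtain q where q: "q \<in> \<rat>" "max 0 l / t0 < q" "q < t / t0"
        using Rats_dense_in_real by blast
      have u: "max 0 l < q * t0" "q * t0 < t" using q(2,3) t0 by (auto simp: field_simps)
      then have "0 < q" using t0 by (simp add: zero_less_mult_iff)
      then have "q * t0 \<in> U" using q(1) by (auto simp: U_def)
      then have "(C (t - q * t0) - cos (c * t - b * (q * t0)) *\<^sub>R 1)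
          * ((C (t - q * t0) - cos (c * t + b * (q * t0)) *\<^sub>R 1) * \<zeta> c) = 0"
        using \<zeta>(2,3)[of c] c by (intro joint_eigen_quadratic) auto
      then show ?thesis
      proof (rule cancel_prod_list[rotated])
        show "prod_list (map (\<lambda>d. C (t - q * t0) - cos (d * (t - q * t0)) *\<^sub>R 1) bs) * \<zeta> c = 0"
          by (simp add: ann)
        show "cos (d * (t - q * t0)) \<noteq> cos (c * t - b * (q * t0))
            \<and> cos (d * (t - q * t0)) \<noteq> cos (c * t + b * (q * t0))" if "d \<in> set bs" for d
          using l(2)[OF _ _ that, of "q * t0"] u by simp
      qed
    qed
    then have "p b = \<zeta> b" unfolding \<zeta>(1) using b by (simp add: sum.remove[of _ b])
    then show ?thesis using \<zeta>(3)[OF b] by simp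
  qed

  have pos: "C t * p b = cos (b * t) *\<^sub>R p b" if b: "b \<in> set bs" and t: "0 < t" for b t
  proof -
    obtain n :: nat where n: "t < real n * t0" using reals_Archimedean3[OF t0] by blast
    then have "n > 0" using t by (intro Nat.gr0I) auto
    then have "0 < t / real n" "t / real n < t0" using t n by (auto simp: field_simps)
    from eigen_multiple[OF small[OF b this], of n] show ?thesis using \<open>n > 0\<close> by simp
  qed
  have "C t * p b = cos (b * t) *\<^sub>R p b" if b: "b \<in> set bs" for b t
  proof -
    consider "t = 0" | "t > 0" | "- t > 0" by linarith
    then show ?thesis using pos[OF b, of t] pos[OF b, of "- t"] by cases (auto simp: zero minus)
  qed
  then show thesis using that[of p] sum pS by auto
qed

end

section \<open>The distance between two scalar cosines\<close>

lemma cos_ge_quadratic: "1 - x\<^sup>2 / 2 \<le> cos x" for x :: real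
proof -
  have "(sin (x/2))\<^sup>2 \<le> (x/2)\<^sup>2"
    using abs_sin_x_le_abs_x[of "x/2"] abs_le_square_iff by blast
  then show ?thesis using cos_double_sin[of "x/2"] by (simp add: power2_eq_square)
qed

text \<open>The quadratic lower bound at \<open>1/8\<close>, doubled three times, is just sharp enough.\<close>
lemma eight_over_3_sqrt_3_le: "8 / (3 * sqrt 3) \<le> 1 + cos (1::real)"
proof -
  have double: "2 * c * c - 1 \<le> cos (2 * x)" if "c \<le> cos x" "0 \<le> c" for c x :: real
    using mult_mono[OF that(1,1)] that cos_double_cos[of x] by (simp add: power2_eq_square)
  have "127/128 \<le> cos (1/8::real)" using cos_ge_quadratic[of "1/8"] by (simp add: power2_eq_square)
  from double[OF this] have "7937/8192 \<le> cos (1/4::real)" by simp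
  from double[OF this] have "877/1000 + 426/1000000 \<le> cos (1/2::real)" by simp
  from double[OF this] have c: "53975/100000 \<le> cos (1::real)" by simp
  have "17319/10000 \<le> sqrt 3" by (rule real_le_rsqrt) (simp add: power2_eq_square)
  then have "8 / (3 * sqrt 3) \<le> 8 / (3 * (17319/10000))"
    by (intro divide_left_mono mult_left_mono) auto
  then show ?thesis using c by simp
qed

text \<open>The first multiple of \<open>\<delta>\<close> not below \<open>1 - e\<close> overshoots
  by less than \<open>\<delta> \<le> 2 * e\<close>.\<close>

lemma multiple_near_1:
  fixes \<delta> e :: real
  assumes "0 < \<delta>" "\<delta> \<le> 2 * e" "e < 1"
  obtains n :: nat where "\<bar>real n * \<delta> - 1\<bar> \<le> e"
proof
  define n where "n = nat \<lceil>(1 - e) / \<delta>\<rceil>"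
  have "0 \<le> (1 - e) / \<delta>" using assms by simp
  then have "real n = of_int \<lceil>(1 - e) / \<delta>\<rceil>" by (simp add: n_def)
  then have "(1 - e) / \<delta> \<le> real n" "real n < (1 - e) / \<delta> + 1" by linarith+
  then have "1 - e \<le> real n * \<delta>" "real n * \<delta> < 1 - e + \<delta>"
    using assms(1) by (simp_all add: field_simps)
  then show "\<bar>real n * \<delta> - 1\<bar> \<le> e" using assms(2) by linarith
qed

text \<open>For \<open>\<eta> = 2/3\<close> all multiples stay at distance at least \<open>1/3\<close> from the odd integers; this is the
  extremal ratio \<open>3\<close> in the sup of \<open>cos_diff_ge\<close>.\<close>
lemma multiple_near_odd:
  fixes \<eta> e :: real
  assumes \<eta>: "0 < \<eta>" "\<eta> \<le> 1" "\<eta> \<noteq> 2/3" and e: "1/4 \<le> e" "e < 1"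
  obtains n :: nat and k :: int where "\<bar>real n * \<eta> - of_int (2 * k + 1)\<bar> \<le> e"
proof -
  consider "\<eta> \<le> 2 * e" | "1 - e \<le> \<eta>" | "2 * e < \<eta>" "\<eta> < 1 - e" by linarith
  then show thesis
  proof cases
    case 1
    then obtain n :: nat where "\<bar>real n * \<eta> - 1\<bar> \<le> e" using multiple_near_1 \<eta>(1) e(2) by blast
    then show thesis using that[of n 0] by simp
  next
    case 2
    then show thesis using that[of 1 0] \<eta>(2) e(1) by simp
  next
    case 3
    \<comment> \<open>Here \<open>\<eta>\<close> lies between 1/2 and 3/4, so
      \<open>3 * \<eta> - 2\<close> is small. Up to the even integer \<open>2 * n\<close>,
      \<open>3 * n * \<eta>\<close> equals \<open>n * (3 * \<eta> - 2)\<close>, which can be steered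
      close to 1 or -1.\<close>
    have "0 < \<bar>3 * \<eta> - 2\<bar>" "\<bar>3 * \<eta> - 2\<bar> \<le> 2 * e" using 3 e \<eta>(3) by auto
    then obtain n :: nat where n: "\<bar>real n * \<bar>3 * \<eta> - 2\<bar> - 1\<bar> \<le> e" using multiple_near_1 e(2) by blast
    show thesis
    proof (cases "3 * \<eta> \<ge> 2")
      case True
      then have "real n * \<bar>3 * \<eta> - 2\<bar> - 1 = real (3 * n) * \<eta> - of_int (2 * int n + 1)"
        by (simp add: algebra_simps)
      then show thesis using that[of "3 * n" "int n"] n by metis
    next
      case False
      then have "- (real n * \<bar>3 * \<eta> - 2\<bar> - 1) = real (3 * n) * \<eta> - of_int (2 * (int n - 1) + 1)"
        by (simp add: algebra_simps)
      then show thesis using that[of "3 * n" "int n - 1"] n by (metis abs_minus_cancel)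
    qed
  qed
qed

text \<open>For \<open>b = 3 * a\<close> the value is the maximum of \<open>4 y - 4 y^3\<close>,
  attained at \<open>y = 1 / sqrt 3\<close>. Otherwise \<open>t b\<close> is taken to be a multiple
  of \<open>pi\<close> and \<open>t a\<close> differs from it by nearly an odd multiple of
  \<open>pi\<close>; the tolerance \<open>1 / pi\<close> leaves an error of at most 1 radian, hence
  the constant \<open>1 + cos 1\<close>.\<close>

lemma cos_diff_ge:
  fixes a b :: real
  assumes "0 \<le> a" "a < b"
  obtains t where "8 / (3 * sqrt 3) \<le> \<bar>cos (t * a) - cos (t * b)\<bar>"
proof (cases "b = 3 * a")
  case True
  define x where "x = arccos (1 / sqrt 3)"
  have "a > 0" using assms True by simp
  have x: "cos x = 1 / sqrt 3" unfolding x_def by (rule cos_arccos) (auto simp: field_simps intro: order_trans[of _ 0])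
  have "cos x - cos (3 * x) = 4 * cos x - 4 * cos x ^ 3" unfolding cos_treble_cos by simp
  also have "\<dots> = 8 / (3 * sqrt 3)" unfolding x by (simp add: power3_eq_cube field_simps)
  finally show thesis using that[of "x / a"] True \<open>a > 0\<close> by (simp add: mult.commute)
next
  case False
  define \<eta> where "\<eta> = 1 - a / b"
  have "0 < \<eta>" "\<eta> \<le> 1" "\<eta> \<noteq> 2/3" using assms False by (auto simp: \<eta>_def field_simps)
  moreover have "1/4 \<le> 1 / pi" "1 / pi < 1" using pi_less_4 pi_ge_two by (auto simp: field_simps)
  ultimately obtain n :: nat and k :: int where nk: "\<bar>real n * \<eta> - of_int (2 * k + 1)\<bar> \<le> 1 / pi"
    by (rule multiple_near_odd)
  define \<epsilon> where "\<epsilon> = pi * (real n * \<eta> - of_int (2 * k + 1))"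
  have "\<bar>\<epsilon>\<bar> = pi * \<bar>real n * \<eta> - of_int (2 * k + 1)\<bar>" unfolding \<epsilon>_def abs_mult by simp
  then have "\<bar>\<epsilon>\<bar> \<le> 1" using mult_left_mono[OF nk pi_ge_zero] by simp
  then have "cos 1 \<le> cos \<bar>\<epsilon>\<bar>" using pi_ge_two by (intro cos_monotone_0_pi_le) auto
  then have \<epsilon>: "cos 1 \<le> cos \<epsilon>" by simp
  define t where "t = real n * pi / b"
  have tb: "t * b = real n * pi" using assms by (simp add: t_def)
  have "t * a = (real n * pi - \<epsilon>) - of_int (2 * k + 1) * pi"
    using assms by (simp add: t_def \<epsilon>_def \<eta>_def field_simps)
  also have "cos \<dots> = - cos (real n * pi - \<epsilon>)"
  proof -
    have "of_int (2 * k + 1) * pi = 2 * pi * of_int k + pi" by (simp add: algebra_simps)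
    then show ?thesis
      using cos_int_2pin[of k] sin_int_2pin[of k]
      by (simp only: cos_diff[of "real n * pi - \<epsilon>"] cos_add sin_add) simp
  qed
  also have "\<dots> = - (cos (real n * pi) * cos \<epsilon>)"
    by (simp add: cos_diff)
  finally have "cos (t * a) - cos (t * b) = - cos (real n * pi) * (1 + cos \<epsilon>)"
    unfolding tb by (simp add: distrib_left)
  then have "\<bar>cos (t * a) - cos (t * b)\<bar> = 1 + cos \<epsilon>"
    using abs_of_nonneg[of "1 + cos \<epsilon>"] cos_ge_minus_one[of \<epsilon>]
    by (simp add: abs_mult power_abs del: cos_ge_minus_one)
  then show thesis using that[of t] \<epsilon> eight_over_3_sqrt_3_le by linarith
qed

lemma bdd_above_cos_diff: "bdd_above (range (\<lambda>t. \<bar>cos (t * a) - cos (t * b)\<bar>))" for a b :: real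
proof (rule bdd_aboveI2)
  show "\<bar>cos (t * a) - cos (t * b)\<bar> \<le> 1 + 1" for t
    by (intro order_trans[OF abs_triangle_ineq4] add_mono) auto
qed

lemma Omega_singleton:
  assumes "m < 8 / (3 * sqrt 3)" "b \<in> Omega a m"
  shows "b = \<bar>a\<bar>"
proof (rule ccontr)
  assume "b \<noteq> \<bar>a\<bar>"
  have b: "b \<ge> 0" using assms(2) by (simp add: Omega_def)
  have eq: "cos (t * \<bar>a\<bar>) = cos (t * a)" for t by (auto simp: abs_if)
  consider "\<bar>a\<bar> < b" | "b < \<bar>a\<bar>" using \<open>b \<noteq> \<bar>a\<bar>\<close> by linarith
  then obtain t where "8 / (3 * sqrt 3) \<le> \<bar>cos (t * a) - cos (t * b)\<bar>"
  proof cases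
    case 1
    then show thesis using cos_diff_ge[of "\<bar>a\<bar>" b] that eq by auto
  next
    case 2
    then show thesis using cos_diff_ge[of b "\<bar>a\<bar>"] that b eq by (auto simp: abs_minus_commute)
  qed
  also have "\<dots> \<le> (SUP t. \<bar>cos (t * a) - cos (t * b)\<bar>)"
    by (rule cSUP_upper[OF UNIV_I bdd_above_cos_diff])
  also have "\<dots> \<le> m" using assms(2) by (simp add: Omega_def)
  finally show False using assms(1) by simp
qed

section \<open>The generated subalgebra\<close>

lemma cscale_0_left [simp]: "cscale 0 x = 0"
  using cscale_of_real[of 0 x] by simp

lemma cscale_0_right [simp]: "cscale c 0 = 0"
  using cscale_add_right[of c 0 0] by simp

lemma cscale_diff_left: "cscale (c - d) x = cscale c x - cscale d x"
  using cscale_add_left[of "c - d" d x] by (simp add: algebra_simps)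

lemma cscale_sum_right: "cscale c (\<Sum>i\<in>I. f i) = (\<Sum>i\<in>I. cscale c (f i))"
  by (induction I rule: infinite_finite_induct) (auto simp: cscale_add_right)

lemma cscale_cancel_right: "cscale c x = cscale d x \<longleftrightarrow> c = d \<or> x = 0"
proof -
  have "norm (cscale c x - cscale d x) = cmod (c - d) * norm x"
    by (simp add: norm_cscale flip: cscale_diff_left)
  then show ?thesis by (metis eq_iff_diff_eq_0 mult_eq_0_iff norm_eq_zero)
qed

text \<open>For \<open>p \<noteq> 0\<close> the map multiplies distances by \<open>norm p\<close>,
  so convergent sequences on the line pull back to Cauchy sequences of complex numbers.\<close>

lemma closed_cscale_line: "closed (range (\<lambda>c. cscale c p))"
proof (cases "p = 0")
  case False
  show ?thesis
    unfolding closed_sequential_limits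
  proof (intro allI impI, elim conjE)
    fix x l assume x: "\<forall>n. x n \<in> range (\<lambda>c. cscale c p)" and l: "x \<longlonglongrightarrow> l"
    then have "\<forall>n. \<exists>c. x n = cscale c p" by auto
    then obtain c where c: "\<And>n. x n = cscale (c n) p" by metis
    have dist: "dist (cscale c1 p) (cscale c2 p) = dist c1 c2 * norm p" for c1 c2
      by (simp add: dist_norm norm_cscale flip: cscale_diff_left)
    have "Cauchy c"
    proof (rule metric_CauchyI)
      fix e :: real assume "0 < e"
      then have "0 < e * norm p" using False by simp
      then obtain M where M: "\<And>m n. m \<ge> M \<Longrightarrow> n \<ge> M \<Longrightarrow> dist (x m) (x n) < e * norm p"
        using LIMSEQ_imp_Cauchy[OF l] metric_CauchyD by blast
      then show "\<exists>M. \<forall>m\<ge>M. \<forall>n\<ge>M. dist (c m) (c n) < e"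
        using False by (auto simp: c dist)
    qed
    then obtain c0 where "c \<longlonglongrightarrow> c0" using Cauchy_convergent convergent_def by blast
    then have "(\<lambda>n. dist (c n) c0 * norm p) \<longlonglongrightarrow> 0"
      using tendsto_mult_left_zero tendsto_dist_iff by blast
    then have "x \<longlonglongrightarrow> cscale c0 p"
      unfolding tendsto_dist_iff[of x] c dist .
    then have "l = cscale c0 p" using l LIMSEQ_unique by blast
    then show "l \<in> range (\<lambda>c. cscale c p)" by blast
  qed
qed simp

lemma closed_subalgebra_generated: "closed_subalgebra (generated_closed_subalgebra X)"
  unfolding generated_closed_subalgebra_def closed_subalgebra_def
  by (intro conjI closed_Inter) auto

lemma generated_closed_subalgebra_superset: "X \<subseteq> generated_closed_subalgebra X"
  unfolding generated_closed_subalgebra_def by auto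

lemma generated_closed_subalgebra_least:
  "closed_subalgebra S \<Longrightarrow> X \<subseteq> S \<Longrightarrow> generated_closed_subalgebra X \<subseteq> S"
  unfolding generated_closed_subalgebra_def by auto

lemma closed_subalgebra_sum:
  assumes "closed_subalgebra S" "\<And>i. i \<in> I \<Longrightarrow> f i \<in> S"
  shows "(\<Sum>i\<in>I. f i) \<in> S"
  using assms(2)
  by (induction I rule: infinite_finite_induct) (use assms(1) in \<open>auto simp: closed_subalgebra_def\<close>)

section \<open>The algebra spanned by orthogonal idempotents\<close>

locale orthogonal_idempotents =
  fixes k :: nat and p :: "nat \<Rightarrow> 'a::complex_banach_algebra"
  assumes mult: "i < k \<Longrightarrow> j < k \<Longrightarrow> p i * p j = (if i = j then p j else 0)"
    and nonzero: "j < k \<Longrightarrow> p j \<noteq> 0"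
begin

definition comb :: "(nat \<Rightarrow> complex) \<Rightarrow> 'a" where
  "comb c = (\<Sum>j<k. cscale (c j) (p j))"

lemma idempotent_times_comb: "i < k \<Longrightarrow> p i * comb c = cscale (c i) (p i)"
  by (simp add: comb_def sum_distrib_left cscale_right_mult mult if_distrib cong: if_cong)

lemma comb_add: "comb c + comb d = comb (\<lambda>j. c j + d j)"
  by (simp add: comb_def cscale_add_left sum.distrib)

lemma comb_mult: "comb c * comb d = comb (\<lambda>j. c j * d j)"
proof -
  have "comb c * comb d = (\<Sum>j<k. cscale (c j) (p j * comb d))"
    by (simp add: comb_def[of c] sum_distrib_right cscale_left_mult)
  also have "\<dots> = comb (\<lambda>j. c j * d j)"
    by (simp add: comb_def[of "\<lambda>j. c j * d j"] idempotent_times_comb cscale_mult)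
  finally show ?thesis .
qed

lemma cscale_comb: "cscale c (comb d) = comb (\<lambda>j. c * d j)"
  by (simp add: comb_def cscale_sum_right cscale_mult)

lemma comb_eqD: "comb c = comb d \<Longrightarrow> j < k \<Longrightarrow> c j = d j"
  by (metis idempotent_times_comb cscale_cancel_right nonzero)

text \<open>Expresses the span by closed conditions: an equation between continuous maps and
  preimages of closed lines.\<close>

lemma range_comb:
  "range comb = {x. (\<Sum>j<k. p j * x) = x} \<inter> (\<Inter>j\<in>{..<k}. (\<lambda>x. p j * x) -` range (\<lambda>c. cscale c (p j)))"
  (is "_ = ?R")
proof
  show "range comb \<subseteq> ?R" by (auto simp: idempotent_times_comb) (simp add: comb_def)
  show "?R \<subseteq> range comb"
  proof
    fix x assume x: "x \<in> ?R"
    then have "\<exists>c. p j * x = cscale c (p j)" if "j < k" for j using that by auto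
    then obtain c where "\<And>j. j < k \<Longrightarrow> p j * x = cscale (c j) (p j)" by metis
    then have "x = comb c" using x by (simp add: comb_def)
    then show "x \<in> range comb" by blast
  qed
qed

lemma closed_subalgebra_range_comb: "closed_subalgebra (range comb)"
proof -
  have "closed (range comb)"
    unfolding range_comb
    by (intro closed_Int closed_INT ballI closed_Collect_eq continuous_closed_vimage closed_cscale_line
        continuous_intros continuous_on_sum)
  moreover have "0 \<in> range comb" by (rule range_eqI[of _ _ "\<lambda>_. 0"]) (simp add: comb_def)
  ultimately show ?thesis
    unfolding closed_subalgebra_def by (auto simp: comb_add comb_mult cscale_comb)
qed

lemma bij_betw_comb: "bij_betw comb (Cpow k) (range comb)"
  unfolding bij_betw_def
proof
  show "inj_on comb (Cpow k)"
  proof (rule inj_onI)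
    fix c d assume c: "c \<in> Cpow k" and d: "d \<in> Cpow k" and "comb c = comb d"
    then have "c j = d j" for j
      using comb_eqD[of c d j] by (cases "j < k") (auto simp: Cpow_def)
    then show "c = d" by blast
  qed
  have "comb c \<in> comb ` Cpow k" for c
    \<comment> \<open>Entries from \<open>k\<close> on do not enter \<open>comb\<close>; setting
      them to 0 lands in \<open>Cpow k\<close>.\<close>
    by (rule image_eqI[of _ _ "\<lambda>j. if j < k then c j else 0"]) (auto simp: comb_def Cpow_def)
  then show "comb ` Cpow k = range comb" by auto
qed

lemma alg_iso_range_comb: "alg_iso_Cpow (range comb) k (inv_into (Cpow k) comb)"
proof -
  let ?\<phi> = "inv_into (Cpow k) comb"
  have inv: "?\<phi> (comb c) = c" if "c \<in> Cpow k" for c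
    by (rule bij_betw_inv_into_left[OF bij_betw_comb that])
  have ex: "\<exists>c\<in>Cpow k. x = comb c" if "x \<in> range comb" for x
    using that bij_betw_comb unfolding bij_betw_def by blast
  show ?thesis
    unfolding alg_iso_Cpow_def
  proof (intro conjI ballI allI)
    show "bij_betw ?\<phi> (range comb) (Cpow k)" by (rule bij_betw_inv_into[OF bij_betw_comb])
  next
    fix x y assume "x \<in> range comb" "y \<in> range comb"
    then obtain c d where c: "c \<in> Cpow k" "x = comb c" and d: "d \<in> Cpow k" "y = comb d"
      using ex by meson
    have "(\<lambda>j. c j + d j) \<in> Cpow k" "(\<lambda>j. c j * d j) \<in> Cpow k" using c d by (auto simp: Cpow_def)
    then show "?\<phi> (x + y) = (\<lambda>j. ?\<phi> x j + ?\<phi> y j)" "?\<phi> (x * y) = (\<lambda>j. ?\<phi> x j * ?\<phi> y j)"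
      using c d by (simp_all add: comb_add comb_mult inv)
  next
    fix z x assume "x \<in> range comb"
    then obtain c where c: "c \<in> Cpow k" "x = comb c" using ex by meson
    then have "(\<lambda>j. z * c j) \<in> Cpow k" by (auto simp: Cpow_def)
    then show "?\<phi> (cscale z x) = (\<lambda>j. z * ?\<phi> x j)" using c by (simp add: cscale_comb inv)
  qed
qed

end

text \<open>The eigenvectors \<open>p b\<close> turn out to be idempotents: they commute with all
  \<open>C t\<close>, distinct frequencies force their products to vanish, and they sum to
  1.\<close>

lemma cosine_function_decomposition:
  fixes C :: "real \<Rightarrow> 'a::complex_banach_algebra"
  assumes C: "cosine_function C"
    and close: "\<And>t. norm (C t - cos (a * t) *\<^sub>R 1) \<le> m" and m: "m < 2"
  obtains k p b where "orthogonal_idempotents k p"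
    and "\<And>j. j < k \<Longrightarrow> p j \<in> generated_closed_subalgebra (range C)"
    and "inj_on b {..<k}" and "\<And>j. j < k \<Longrightarrow> b j \<in> Omega a m"
    and "\<And>t. C t = (\<Sum>j<k. cos (b j * t) *\<^sub>R p j)"
proof -
  define A where "A = generated_closed_subalgebra (range C)"
  have A: "closed_subalgebra A" unfolding A_def by (rule closed_subalgebra_generated)
  have CA: "C t \<in> A" for t unfolding A_def using generated_closed_subalgebra_superset[of "range C"] by auto
  have "norm (C t) \<le> 1 + m" for t
  proof -
    have "norm (C t) \<le> norm (C t - cos (a * t) *\<^sub>R 1) + norm (cos (a * t) *\<^sub>R (1::'a))"
      by (metis diff_add_cancel norm_triangle_ineq)
    then show ?thesis using close[of t] abs_cos_le_one[of "a * t"]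
      by (simp del: abs_cos_le_one)
  qed
  then interpret bounded_cosine_family C "1 + m"
    using C by unfold_locales (auto simp: cosine_function_def)
  obtain bs where bs: "distinct bs" "\<And>b. b \<in> set bs \<Longrightarrow> 0 \<le> b"
    and ann: "\<And>t. prod_list (map (\<lambda>b. C t - cos (b * t) *\<^sub>R 1) bs) = 0"
    using annihilating_list[OF close m] by blast
  have "subspace A"
    using A unfolding subspace_def closed_subalgebra_def by (metis cscale_of_real)
  moreover have "C t * w \<in> A" if "w \<in> A" for t w
    using that A CA unfolding closed_subalgebra_def by blast
  moreover have "1 \<in> A" using CA[of 0] by (simp add: zero)
  ultimately obtain p where sum: "(\<Sum>b\<in>set bs. p b) = 1"
    and pA: "\<And>b. b \<in> set bs \<Longrightarrow> p b \<in> A"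
    and eig: "\<And>b t. b \<in> set bs \<Longrightarrow> C t * p b = cos (b * t) *\<^sub>R p b"
    using eigen_decomposition[OF bs ann] by blast
  \<comment> \<open>Zero components are dropped: they would spoil injectivity of
    \<open>comb\<close>, and their frequencies need not lie in \<open>Omega a m\<close>.\<close>
  define B where "B = {b \<in> set bs. p b \<noteq> 0}"
  have "finite B" by (simp add: B_def)
  have sumB: "(\<Sum>b\<in>set bs. h b *\<^sub>R p b) = (\<Sum>b\<in>B. h b *\<^sub>R p b)" for h
    unfolding B_def by (rule sum.mono_neutral_right) auto
  have comm: "p b * C t = C t * p b" if "b \<in> B" for b t
  proof -
    \<comment> \<open>The centraliser of all \<open>C t\<close> is a closed subalgebra containing
      \<open>range C\<close>, hence contains \<open>A\<close>.\<close>
    let ?Z = "{x. \<forall>t. x * C t = C t * x}"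
    have "closed ?Z"
      unfolding Collect_all_eq by (intro closed_INT ballI closed_Collect_eq continuous_intros)
    then have "closed_subalgebra ?Z"
      unfolding closed_subalgebra_def
      by (simp add: distrib_left distrib_right cscale_left_mult cscale_right_mult mult.assoc)
        (simp flip: mult.assoc)
    then have "A \<subseteq> ?Z"
      unfolding A_def by (rule generated_closed_subalgebra_least) (auto simp: commute)
    then show ?thesis using that pA by (auto simp: B_def)
  qed
  have orth: "p b * p c = 0" if b: "b \<in> B" and c: "c \<in> B" and "b \<noteq> c" for b c
  proof (rule ccontr)
    assume ne: "p b * p c \<noteq> 0"
    have "cos (b * t) = cos (c * t)" for t
    proof -
      have "cos (b * t) *\<^sub>R (p b * p c) = C t * p b * p c" using eig b by (simp add: B_def)
      also have "\<dots> = p b * (C t * p c)" using comm[OF b] by (simp flip: mult.assoc)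
      also have "\<dots> = cos (c * t) *\<^sub>R (p b * p c)" using eig c by (simp add: B_def)
      finally show ?thesis using ne by simp
    qed
    note eq = this
    have "0 \<le> b" "0 \<le> c" using b c bs(2) by (auto simp: B_def)
    \<comment> \<open>Puts both \<open>b * t\<close> and \<open>c * t\<close> into the interval from
      0 to \<open>pi\<close>, where \<open>cos\<close> is injective.\<close>
    define t where "t = pi / (b + c)"
    have "0 < b + c" using \<open>0 \<le> b\<close> \<open>0 \<le> c\<close> \<open>b \<noteq> c\<close> by linarith
    then have "b * t \<le> pi" "c * t \<le> pi" "0 \<le> b * t" "0 \<le> c * t" "0 < t"
      using \<open>0 \<le> b\<close> \<open>0 \<le> c\<close> by (auto simp: t_def field_simps)
    then have "b * t = c * t" using eq[of t] cos_inj_pi by blast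
    then show False using \<open>b \<noteq> c\<close> \<open>0 < t\<close> by simp
  qed
  have idem: "p b * p b = p b" if b: "b \<in> B" for b
  proof -
    have "p b = p b * (\<Sum>c\<in>B. p c)" using sum sumB[of "\<lambda>_. 1"] by simp
    also have "\<dots> = p b * p b + (\<Sum>c\<in>B - {b}. p b * p c)"
      using b \<open>finite B\<close> by (simp add: sum_distrib_left distrib_left sum.remove)
    also have "(\<Sum>c\<in>B - {b}. p b * p c) = 0" using b orth by (intro sum.neutral) auto
    finally show ?thesis by simp
  qed
  obtain h where h: "bij_betw h {..<card B} B"
    using ex_bij_betw_nat_finite[OF \<open>finite B\<close>] by (auto simp: atLeast0LessThan)
  have hB: "h j \<in> B" if "j < card B" for j using h that by (auto simp: bij_betw_def)
  have inj: "inj_on h {..<card B}" using h by (simp add: bij_betw_def)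
  show thesis
  proof (rule that[of "card B" "\<lambda>j. p (h j)" h])
    show "orthogonal_idempotents (card B) (\<lambda>j. p (h j))"
    proof
      show "p (h i) * p (h j) = (if i = j then p (h j) else 0)" if "i < card B" "j < card B" for i j
      proof (cases "i = j")
        case False
        then have "h i \<noteq> h j" using inj that by (auto dest: inj_onD)
        then show ?thesis using orth[OF hB hB] that False by simp
      qed (use idem[OF hB] that in simp)
      show "p (h j) \<noteq> 0" if "j < card B" for j using hB[OF that] by (simp add: B_def)
    qed
    show "p (h j) \<in> generated_closed_subalgebra (range C)" if "j < card B" for j
      using hB[OF that] pA by (simp add: B_def A_def)
    show "inj_on h {..<card B}" by (rule inj)
    show "h j \<in> Omega a m" if j: "j < card B" for j
    proof -
      let ?b = "h j"
      have b: "?b \<in> set bs" "p ?b \<noteq> 0" using hB[OF j] by (auto simp: B_def)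
      have "\<bar>cos (t * a) - cos (t * ?b)\<bar> \<le> m" for t
      proof -
        \<comment> \<open>The difference acts on the nonzero \<open>p ?b\<close> as a scalar, whose
          modulus is therefore at most its norm.\<close>
        have "(C t - cos (a * t) *\<^sub>R 1) * p ?b = (cos (t * ?b) - cos (t * a)) *\<^sub>R p ?b"
          using eig[OF b(1), of t] by (simp add: left_diff_distrib scaleR_left_diff_distrib mult.commute)
        then have "\<bar>cos (t * ?b) - cos (t * a)\<bar> * norm (p ?b) \<le> norm (C t - cos (a * t) *\<^sub>R 1) * norm (p ?b)"
          by (metis norm_mult_ineq norm_scaleR)
        then have "\<bar>cos (t * ?b) - cos (t * a)\<bar> \<le> norm (C t - cos (a * t) *\<^sub>R 1)"
          using b(2) by simp
        then show ?thesis using close[of t] by (simp add: abs_minus_commute)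
      qed
      then have "(SUP t. \<bar>cos (t * a) - cos (t * ?b)\<bar>) \<le> m" by (intro cSUP_least) auto
      then show ?thesis using bs(2)[OF b(1)] by (simp add: Omega_def)
    qed
    show "C t = (\<Sum>j<card B. cos (h j * t) *\<^sub>R p (h j))" for t
    proof -
      have "C t = C t * (\<Sum>b\<in>set bs. p b)" by (simp add: sum)
      also have "\<dots> = (\<Sum>b\<in>set bs. cos (b * t) *\<^sub>R p b)"
        unfolding sum_distrib_left by (intro sum.cong) (auto simp: eig)
      also have "\<dots> = (\<Sum>j<card B. cos (h j * t) *\<^sub>R p (h j))"
        unfolding sumB by (rule sum.reindex_bij_betw[OF h, symmetric])
      finally show ?thesis .
    qed
  qed
qed

theorem theorem3p6:
  fixes C :: "real \<Rightarrow> 'a::complex_banach_algebra"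
  assumes "cosine_function C"
  defines "A1 \<equiv> generated_closed_subalgebra (range C)"
  shows
   "(\<forall>a::real. bdd_above (range (\<lambda>t. norm (C t - cos (a * t) *\<^sub>R 1))) \<and>
        (SUP t. norm (C t - cos (a * t) *\<^sub>R 1)) < 2 \<longrightarrow>
      (let m = (SUP t. norm (C t - cos (a * t) *\<^sub>R 1)) in
       \<exists>k \<phi> (p::nat \<Rightarrow> 'a) (b::nat \<Rightarrow> real).
         alg_iso_Cpow A1 k \<phi> \<and>
         (finite (Omega a m) \<longrightarrow> k \<le> card (Omega a m)) \<and>
         (\<forall>j<k. p j \<in> A1 \<and> p j * p j = p j) \<and>
         (\<forall>i<k. \<forall>j<k. i \<noteq> j \<longrightarrow> p i * p j = 0) \<and>
         inj_on b {..<k} \<and> (\<forall>j<k. b j \<in> Omega a m) \<and>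
         (\<forall>t. C t = (\<Sum>j<k. cos (b j * t) *\<^sub>R p j))))
    \<and>
    (\<forall>a::real. bdd_above (range (\<lambda>t. norm (C t - cos (a * t) *\<^sub>R 1))) \<and>
        (SUP t. norm (C t - cos (a * t) *\<^sub>R 1)) < 8 / (3 * sqrt 3) \<longrightarrow>
      (\<forall>t. C t = cos (a * t) *\<^sub>R 1))"
proof (intro conjI allI impI)
  fix a :: real
  define m where "m = (SUP t. norm (C t - cos (a * t) *\<^sub>R 1))"
  assume "bdd_above (range (\<lambda>t. norm (C t - cos (a * t) *\<^sub>R 1))) \<and>
    (SUP t. norm (C t - cos (a * t) *\<^sub>R 1)) < 2"
  then have bdd: "bdd_above (range (\<lambda>t. norm (C t - cos (a * t) *\<^sub>R 1)))" and m: "m < 2"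
    by (auto simp: m_def)
  have close: "norm (C t - cos (a * t) *\<^sub>R 1) \<le> m" for t
    unfolding m_def by (rule cSUP_upper[OF UNIV_I bdd])
  obtain k p b where kpb: "orthogonal_idempotents k p" "\<And>j. j < k \<Longrightarrow> p j \<in> A1"
    "inj_on b {..<k}" "\<And>j. j < k \<Longrightarrow> b j \<in> Omega a m" "\<And>t. C t = (\<Sum>j<k. cos (b j * t) *\<^sub>R p j)"
    using cosine_function_decomposition[OF assms(1) close m] unfolding A1_def by blast
  interpret orthogonal_idempotents k p by (rule kpb)
  have A1: "closed_subalgebra A1" unfolding A1_def by (rule closed_subalgebra_generated)
  \<comment> \<open>One inclusion is minimality of \<open>A1\<close>, the other holds because the
    idempotents themselves lie in \<open>A1\<close>.\<close>
  have "A1 = range comb"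
  proof
    have "C t = comb (\<lambda>j. complex_of_real (cos (b j * t)))" for t
      unfolding kpb(5)[of t] comb_def by (simp only: cscale_of_real)
    then show "A1 \<subseteq> range comb"
      unfolding A1_def by (intro generated_closed_subalgebra_least closed_subalgebra_range_comb) auto
    show "range comb \<subseteq> A1"
      using A1 kpb(2) unfolding comb_def
      by (auto intro!: closed_subalgebra_sum simp: closed_subalgebra_def)
  qed
  then have "alg_iso_Cpow A1 k (inv_into (Cpow k) comb)" using alg_iso_range_comb by simp
  moreover have "finite (Omega a m) \<longrightarrow> k \<le> card (Omega a m)"
    using card_inj_on_le[OF kpb(3), of "Omega a m"] kpb(4) by auto
  ultimately show "let m = (SUP t. norm (C t - cos (a * t) *\<^sub>R 1)) in
       \<exists>k \<phi> (p::nat \<Rightarrow> 'a) (b::nat \<Rightarrow> real).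
         alg_iso_Cpow A1 k \<phi> \<and>
         (finite (Omega a m) \<longrightarrow> k \<le> card (Omega a m)) \<and>
         (\<forall>j<k. p j \<in> A1 \<and> p j * p j = p j) \<and>
         (\<forall>i<k. \<forall>j<k. i \<noteq> j \<longrightarrow> p i * p j = 0) \<and>
         inj_on b {..<k} \<and> (\<forall>j<k. b j \<in> Omega a m) \<and>
         (\<forall>t. C t = (\<Sum>j<k. cos (b j * t) *\<^sub>R p j))"
    unfolding Let_def m_def[symmetric]
    by (intro exI[of _ k] exI[of _ "inv_into (Cpow k) comb"] exI[of _ p] exI[of _ b])
      (use kpb(2-4) in \<open>auto simp: mult intro: kpb(5)\<close>)
next
  fix a t :: real
  define m where "m = (SUP t. norm (C t - cos (a * t) *\<^sub>R 1))"
  assume "bdd_above (range (\<lambda>t. norm (C t - cos (a * t) *\<^sub>R 1))) \<and>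
    (SUP t. norm (C t - cos (a * t) *\<^sub>R 1)) < 8 / (3 * sqrt 3)"
  then have bdd: "bdd_above (range (\<lambda>t. norm (C t - cos (a * t) *\<^sub>R 1)))"
    and m: "m < 8 / (3 * sqrt 3)" by (auto simp: m_def)
  have close: "norm (C t - cos (a * t) *\<^sub>R 1) \<le> m" for t
    unfolding m_def by (rule cSUP_upper[OF UNIV_I bdd])
  have "m < 2" using m eight_over_3_sqrt_3_le cos_le_one[of 1] by linarith
  show "C t = cos (a * t) *\<^sub>R 1"
  proof (rule cosine_function_decomposition[OF assms(1) close \<open>m < 2\<close>])
    fix k b and p :: "nat \<Rightarrow> 'a"
    assume b: "\<And>j. j < k \<Longrightarrow> b j \<in> Omega a m" and C: "\<And>t. C t = (\<Sum>j<k. cos (b j * t) *\<^sub>R p j)"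
    \<comment> \<open>Below the critical constant every \<open>b j\<close> equals
      \<open>\<bar>a\<bar>\<close>, so \<open>C\<close> is a scalar cosine times the sum of the
      \<open>p j\<close>; evaluation at 0 shows that this sum is 1.\<close>
    have "cos (b j * t) = cos (a * t)" if "j < k" for j t
      using Omega_singleton[OF m b[OF that]] by (auto simp: abs_if)
    then have C': "C t = cos (a * t) *\<^sub>R (\<Sum>j<k. p j)" for t
      unfolding C by (simp add: scaleR_sum_right)
    have "C 0 = 1" using assms(1) by (simp add: cosine_function_def)
    then have "(\<Sum>j<k. p j) = 1" using C'[of 0] by simp
    then show ?thesis using C'[of t] by simp
  qed
qed

end
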